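(* Let $K$ be a field with $\tfrac12\in K$ (i.e. of characteristic different from $2$), let $x=(x_1,\ldots,x_n)$, and let $H=(H_1,\ldots,H_m)\in K[x]^m$ be a quadratic polynomial map over $K$ such that $r:=\operatorname{rk}\mathcal{J}H\le 2$. Then there exist polynomials $f_1,\ldots,f_r\in K[x]$ such that $K[H]\subseteq K[f_1,\ldots,f_r]$. In particular, $\operatorname{rk}\mathcal{J}H=\operatorname{trdeg}_K K(H)$.
   Context: The degree of $H$ is $\max_i\deg H_i$; quadratic means of degree at most $2$. $\mathcal{J}H=\left(\frac{\partial H_i}{\partial x_j}\right)_{i,j}$ is the Jacobian matrix, with rank taken over $K(x)$. $K[H]=K[H_1,\ldots,H_m]$ is the $K$-subalgebra of $K[x]$ generated by the components of $H$, $K(H)=K(H_1,\ldots,H_m)$ is the corresponding subfield of $K(x)$, and $\operatorname{trdeg}_K$ denotes transcendence degree over $K$. *)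

theory Defs
  imports
    "HOL-Analysis.Analysis"
    "HOL-Library.Poly_Mapping"
    "HOL-Library.Extended_Nat"
    "HOL-Computational_Algebra.Fraction_Field"
begin

text \<open>
  A monomial is a finitely supported exponent vector, and a polynomial a finitely supported
  family of coefficients indexed by monomials; \<^theory>\<open>HOL-Library.Poly_Mapping\<close> provides the
  convolution product. For a finite index type \<open>'n\<close>, the type \<open>('n, 'k) mpoly\<close> is thus the
  polynomial ring over \<open>'k\<close> in \<open>CARD('n)\<close> variables. A linear order on \<open>'n\<close> is needed only for the
  library's \<open>idom\<close> instance, which is required for forming the field of fractions.
\<close>

type_synonym ('n, 'k) mpoly = "('n \<Rightarrow>\<^sub>0 nat) \<Rightarrow>\<^sub>0 'k"

type_synonym ('n, 'k) mratfun = "('n, 'k) mpoly fract"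

definition mconst :: "'k \<Rightarrow> ('n, 'k::zero) mpoly"
  where "mconst c = Poly_Mapping.single 0 c"

definition to_mratfun :: "('n::linorder, 'k::field) mpoly \<Rightarrow> ('n, 'k) mratfun"
  where "to_mratfun p = Fract p 1"

definition ratconst :: "'k::field \<Rightarrow> ('n::linorder, 'k) mratfun"
  where "ratconst c = to_mratfun (mconst c)"

definition monom_degree :: "('n \<Rightarrow>\<^sub>0 nat) \<Rightarrow> nat"
  where "monom_degree e = (\<Sum>i\<in>Poly_Mapping.keys e. Poly_Mapping.lookup e i)"

text \<open>The zero polynomial is given total degree 0.\<close>

definition total_degree :: "('n, 'k::zero) mpoly \<Rightarrow> nat"
  where "total_degree p = Max (insert 0 (monom_degree ` Poly_Mapping.keys p))"

definition map_degree :: "('n, 'k::zero) mpoly ^ 'm::finite \<Rightarrow> nat"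
  where "map_degree H = Max (range (\<lambda>i. total_degree (H $ i)))"

definition quadratic_map :: "('n, 'k::zero) mpoly ^ 'm::finite \<Rightarrow> bool"
  where "quadratic_map H \<longleftrightarrow> map_degree H \<le> 2"

text \<open>
  Differentiation maps \<open>c x\<^sup>e\<close> to \<open>e\<^sub>j c x\<^sup>e\<^sup>'\<close> with \<open>e'\<close> obtained from \<open>e\<close> by lowering the exponent at
  \<open>j\<close>. Subtraction of exponents truncates, but only where the coefficient \<open>e\<^sub>j\<close> vanishes.
\<close>

definition partial_deriv :: "'n \<Rightarrow> ('n, 'k::comm_semiring_1) mpoly \<Rightarrow> ('n, 'k) mpoly"
  where "partial_deriv j p =
    (\<Sum>e\<in>Poly_Mapping.keys p.
       Poly_Mapping.single (e - Poly_Mapping.single j 1)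
         (of_nat (Poly_Mapping.lookup e j) * Poly_Mapping.lookup p e))"

definition jacobian_matrix ::
  "('n::{finite,linorder}, 'k::field) mpoly ^ 'm::finite
   \<Rightarrow> ('n::{finite,linorder}, 'k) mratfun ^ 'n::{finite,linorder} ^ 'm::finite"
  where "jacobian_matrix H = (\<chi> i j. to_mratfun (partial_deriv j (H $ i)))"

definition mpoly_subalgebra :: "('n, 'k::comm_ring_1) mpoly set \<Rightarrow> bool"
  where "mpoly_subalgebra A \<longleftrightarrow>
    range mconst \<subseteq> A \<and> (\<forall>p\<in>A. \<forall>q\<in>A. p + q \<in> A) \<and> (\<forall>p\<in>A. \<forall>q\<in>A. p * q \<in> A)"

definition generated_subalgebra :: "('n, 'k::comm_ring_1) mpoly set \<Rightarrow> ('n, 'k) mpoly set"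
  where "generated_subalgebra S = mpoly_subalgebra hull S"

text \<open>
  For field extensions, \<open>\<iota> :: 'k \<Rightarrow> 'l\<close> is the embedding of the base field into the larger field.
\<close>

definition intermediate_field :: "('k::field \<Rightarrow> 'l::field) \<Rightarrow> 'l set \<Rightarrow> bool"
  where "intermediate_field \<iota> L \<longleftrightarrow>
    range \<iota> \<subseteq> L \<and> (\<forall>a\<in>L. \<forall>b\<in>L. a + b \<in> L) \<and> (\<forall>a\<in>L. - a \<in> L) \<and>
    (\<forall>a\<in>L. \<forall>b\<in>L. a * b \<in> L) \<and> (\<forall>a\<in>L. inverse a \<in> L)"

definition generated_field :: "('k::field \<Rightarrow> 'l::field) \<Rightarrow> 'l set \<Rightarrow> 'l set"
  where "generated_field \<iota> S = intermediate_field \<iota> hull S"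

definition mpoly_eval :: "('k::zero \<Rightarrow> 'l::comm_semiring_1) \<Rightarrow> ('v \<Rightarrow> 'l) \<Rightarrow> ('v, 'k) mpoly \<Rightarrow> 'l"
  where "mpoly_eval \<iota> a p =
    (\<Sum>e\<in>Poly_Mapping.keys p.
       \<iota> (Poly_Mapping.lookup p e) * (\<Prod>v\<in>Poly_Mapping.keys e. a v ^ Poly_Mapping.lookup e v))"

definition mpoly_vars :: "('v, 'k::zero) mpoly \<Rightarrow> 'v set"
  where "mpoly_vars p = (\<Union>e\<in>Poly_Mapping.keys p. Poly_Mapping.keys e)"

text \<open>
  Here the elements of \<open>S\<close> themselves index the variables of the polynomial \<open>p\<close>, and each variable
  is evaluated at the element indexing it.
\<close>

definition algebraically_independent :: "('k::field \<Rightarrow> 'l::field) \<Rightarrow> 'l set \<Rightarrow> bool"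
  where "algebraically_independent \<iota> S \<longleftrightarrow>
    (\<forall>p :: ('l, 'k) mpoly. mpoly_vars p \<subseteq> S \<longrightarrow> mpoly_eval \<iota> (\<lambda>v. v) p = 0 \<longrightarrow> p = 0)"

text \<open>
  The largest cardinality of an algebraically independent subset of \<open>L\<close>, as an extended natural
  number. Restricting to finite subsets loses nothing: subsets of independent sets are
  independent, so an infinite one forces the supremum to be \<open>\<infinity>\<close>.
\<close>

definition trdeg :: "('k::field \<Rightarrow> 'l::field) \<Rightarrow> 'l set \<Rightarrow> enat"
  where "trdeg \<iota> L =
    Sup {enat (card S) | S. finite S \<and> S \<subseteq> L \<and> algebraically_independent \<iota> S}"

end

theory Submission
  imports Defs
begin

text \<open>
  Choose a rational point \<open>v\<close> at which \<open>JH\<close> already has its generic rank \<open>r\<close>; it exists because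
  the minors involved are polynomials of degree at most two and \<open>2 \<noteq> 0\<close>. Restricting the vanishing
  minors of size \<open>r + 1\<close> to the lines \<open>v + s w\<close> and comparing coefficients of \<open>s\<close> gives identities
  between the gradients at \<open>v\<close> and the Hessians of the linear combinations of the \<open>H\<^sub>i\<close>. If no
  nonconstant combination is singular at \<open>v\<close>, then \<open>r\<close> combinations span all of them up to
  constants. Otherwise a singular combination \<open>G\<close> is a quadratic form in the \<open>r\<close> gradients, and the
  identities for \<open>G\<close> force every combination to be a polynomial in these \<open>r\<close> linear forms, or
  (for \<open>r = 2\<close>) every combination to lie in the span of \<open>1\<close>, \<open>\<alpha>\<close>, \<open>\<alpha>\<^sup>2\<close> and one further
  combination \<open>H'\<close>, with \<open>\<alpha>\<close> linear.

  The transcendence degree is bounded above by counting monomials, and below by substituting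
  \<open>v + s\<^sup>N e\<^sub>1 + s\<^sup>N\<^sup>+\<^sup>1 e\<^sub>2\<close> with \<open>e\<^sub>1\<close>, \<open>e\<^sub>2\<close> dual to two gradients: the resulting orders of vanishing
  prevent cancellation in a polynomial relation, in every characteristic.
\<close>

section \<open>Singular members of families of quadratic polynomials\<close>

text \<open>Up to its constant term a combination is determined by its differential at
  \<open>v\<close> and its Hessian. The classification therefore works with the data
  \<open>g y\<close> and \<open>B y\<close> alone, and dual pairs take the place of a change of
  coordinates.

  The gradient of a quadratic polynomial is affine along a line, so a minor of size r + 1 on
  \<open>v + s w\<close> has degree at most r + 1 in s. It vanishes as a formal polynomial, so its
  coefficients vanish over small fields too. If one row comes from a combination G singular at
  \<open>v\<close>, that row has no constant term; the coefficients of s, s^2 and (for r = 2) s^3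
  then give relations that are linear, quadratic and cubic in Hessians, and each one is simplified
  by the previous ones.

  In positive characteristic the Jacobian rank can be smaller than the transcendence degree, as x^p
  shows. The bound of the transcendence degree by r is therefore not derived from derivatives: it
  follows from having found r polynomials that generate an algebra containing every H_i.\<close>

definition det2 :: "('t \<Rightarrow> 'a::comm_ring_1) \<Rightarrow> ('t \<Rightarrow> 'a) \<Rightarrow> 't \<Rightarrow> 't \<Rightarrow> 'a"
  where "det2 f g s t = f s * g t - f t * g s"

definition det3 :: "('t \<Rightarrow> 'a::comm_ring_1) \<Rightarrow> ('t \<Rightarrow> 'a) \<Rightarrow> ('t \<Rightarrow> 'a) \<Rightarrow> 't \<Rightarrow> 't \<Rightarrow> 't \<Rightarrow> 'a"
  where "det3 f g h s t u = f s * det2 g h t u - f t * det2 g h s u + f u * det2 g h s t"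

text \<open>The coefficient of s^k collects the determinants in which exactly k rows are replaced by
  their primed versions.\<close>

lemma det2_pencil_eq_0:
  fixes f f' g g' :: "'t \<Rightarrow> 'a::comm_ring_1"
  assumes "det2 (\<lambda>t. [:f t, f' t:]) (\<lambda>t. [:g t, g' t:]) s t = 0"
  shows "det2 f g s t = 0" "det2 f' g s t + det2 f g' s t = 0" "det2 f' g' s t = 0"
proof -
  have *: "[:det2 f g s t, det2 f' g s t + det2 f g' s t, det2 f' g' s t:] = 0"
    using assms unfolding det2_def by (simp add: algebra_simps)
  show "det2 f g s t = 0" "det2 f' g s t + det2 f g' s t = 0" "det2 f' g' s t = 0"
    using * by simp_all
qed

lemma det3_pencil_eq_0:
  fixes f f' g g' h h' :: "'t \<Rightarrow> 'a::comm_ring_1"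
  assumes "det3 (\<lambda>t. [:f t, f' t:]) (\<lambda>t. [:g t, g' t:]) (\<lambda>t. [:h t, h' t:]) s t u = 0"
  shows "det3 f g h s t u = 0"
    "det3 f' g h s t u + det3 f g' h s t u + det3 f g h' s t u = 0"
    "det3 f' g' h s t u + det3 f' g h' s t u + det3 f g' h' s t u = 0"
    "det3 f' g' h' s t u = 0"
proof -
  have *: "[:det3 f g h s t u,
    det3 f' g h s t u + det3 f g' h s t u + det3 f g h' s t u,
    det3 f' g' h s t u + det3 f' g h' s t u + det3 f g' h' s t u,
    det3 f' g' h' s t u:] = 0"
    using assms unfolding det3_def det2_def by (simp add: algebra_simps)
  show "det3 f g h s t u = 0"
    "det3 f' g h s t u + det3 f g' h s t u + det3 f g h' s t u = 0"
    "det3 f' g' h s t u + det3 f' g h' s t u + det3 f g' h' s t u = 0"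
    "det3 f' g' h' s t u = 0"
    using * by simp_all
qed

text \<open>
  For a linear combination of the \<open>H\<^sub>i\<close> with coefficient vector \<open>y\<close>, the scalars \<open>g y t\<close> and \<open>B y w t\<close>
  are its first derivative at a fixed base point and its constant second derivative.
\<close>

locale quadratic_family =
  fixes g :: "'k::field^'m::finite \<Rightarrow> 'k^'n::finite \<Rightarrow> 'k"
    and B :: "'k^'m::finite \<Rightarrow> 'k^'n::finite \<Rightarrow> 'k^'n::finite \<Rightarrow> 'k"
  assumes two: "(2::'k) \<noteq> 0"
    and g_add_left: "g (y + y') t = g y t + g y' t"
    and g_scale_left: "g (c *s y) t = c * g y t"
    and g_add_right: "g y (t + t') = g y t + g y t'"
    and g_scale_right: "g y (c *s t) = c * g y t"
    and B_add_left: "B (y + y') w t = B y w t + B y' w t"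
    and B_scale_left: "B (c *s y) w t = c * B y w t"
    and B_add_right: "B y w (t + t') = B y w t + B y w t'"
    and B_scale_right: "B y w (c *s t) = c * B y w t"
    and B_commute: "B y w t = B y t w"
begin

lemma B_add_mid: "B y (w + w') t = B y w t + B y w' t"
  by (simp add: B_commute[of _ _ t] B_add_right)

lemma B_scale_mid: "B y (c *s w) t = c * B y w t"
  by (simp add: B_commute[of _ _ t] B_scale_right)

lemma g_diff_left: "g (y - y') t = g y t - g y' t"
  using g_add_left[of "y - y'" y' t] by simp

lemma g_diff_right: "g y (t - t') = g y t - g y t'"
  using g_add_right[of y "t - t'" t'] by simp

lemma B_diff_left: "B (y - y') w t = B y w t - B y' w t"
  using B_add_left[of "y - y'" y' w t] by simp

lemma B_diff_right: "B y w (t - t') = B y w t - B y w t'"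
  using B_add_right[of y w "t - t'" t'] by simp

lemmas linear_simps =
  g_add_left g_scale_left g_add_right g_scale_right g_diff_left g_diff_right
  B_add_left B_scale_left B_add_right B_scale_right B_add_mid B_scale_mid
  B_diff_left B_diff_right

text \<open>Polarisation; one of the places where characteristic two has to be excluded.\<close>

lemma B_nonzero_diag:
  assumes "B y w t \<noteq> 0"
  obtains e where "B y e e \<noteq> 0"
proof -
  have "B y (w + t) (w + t) - B y w w - B y t t = 2 * B y w t"
    by (simp add: linear_simps B_commute[of y t w])
  with assms two that show ?thesis
    by (metis diff_zero mult_eq_0_iff)
qed

definition dual_pair :: "'k^'m \<Rightarrow> 'k^'m \<Rightarrow> 'k^'n \<Rightarrow> 'k^'n \<Rightarrow> bool"
  where "dual_pair h1 h2 e1 e2 \<longleftrightarrow> g h1 e1 = 1 \<and> g h1 e2 = 0 \<and> g h2 e1 = 0 \<and> g h2 e2 = 1"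

text \<open>Cramer's rule: the coefficients of \<open>h1\<close> and \<open>h2\<close> are the rows
  of the inverse of the 2 by 2 matrix with entries \<open>g yi tj\<close>.\<close>

lemma dual_pair_exists:
  assumes "det2 (g y1) (g y2) t1 t2 \<noteq> 0"
  obtains h1 h2 where "dual_pair h1 h2 t1 t2"
proof -
  define d where "d = det2 (g y1) (g y2) t1 t2"
  have d: "d \<noteq> 0" using assms d_def by simp
  define h1 where "h1 = (g y2 t2 / d) *s y1 - (g y1 t2 / d) *s y2"
  define h2 where "h2 = (g y1 t1 / d) *s y2 - (g y2 t1 / d) *s y1"
  have "dual_pair h1 h2 t1 t2"
    using d unfolding dual_pair_def h1_def h2_def
    by (simp add: linear_simps field_simps) (simp add: d_def det2_def algebra_simps)
  then show ?thesis using that by blast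
qed

lemma dual_pair_decompose:
  assumes "dual_pair h1 h2 e1 e2"
  obtains u where "w = g h1 w *s e1 + g h2 w *s e2 + u" "g h1 u = 0" "g h2 u = 0"
proof
  show "w = g h1 w *s e1 + g h2 w *s e2 + (w - g h1 w *s e1 - g h2 w *s e2)"
    by simp
qed (use assms in \<open>simp_all add: dual_pair_def linear_simps\<close>)

text \<open>If the common kernel of the two gradients lies in the radical of the form, the form
  descends to a two-dimensional quotient. There \<open>e1\<close>, \<open>e2\<close> give a basis
  with coordinate functions \<open>g h1\<close>, \<open>g h2\<close>.\<close>

lemma dual_pair_expand:
  assumes "dual_pair h1 h2 e1 e2" and u: "\<And>w u. g h1 u = 0 \<Longrightarrow> g h2 u = 0 \<Longrightarrow> B y w u = 0"
  shows "B y w t = B y e1 e1 * (g h1 w * g h1 t) + B y e1 e2 * (g h1 w * g h2 t + g h2 w * g h1 t)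
    + B y e2 e2 * (g h2 w * g h2 t)"
proof -
  obtain u where w: "w = g h1 w *s e1 + g h2 w *s e2 + u" "g h1 u = 0" "g h2 u = 0"
    using dual_pair_decompose[OF assms(1)] .
  obtain u' where t: "t = g h1 t *s e1 + g h2 t *s e2 + u'" "g h1 u' = 0" "g h2 u' = 0"
    using dual_pair_decompose[OF assms(1)] .
  define a b a' b' where "a = g h1 w" "b = g h2 w" "a' = g h1 t" "b' = g h2 t"
  have w': "w = a *s e1 + b *s e2 + u" and t': "t = a' *s e1 + b' *s e2 + u'"
    using w t by (simp_all add: a_b_a'_b'_def)
  have z: "B y x u = 0" "B y x u' = 0" "B y u x = 0" for x
    using assms(2) w t by (simp_all add: B_commute[of y u])
  have "B y w t = B y e1 e1 * (a * a') + B y e1 e2 * (a * b' + b * a') + B y e2 e2 * (b * b')"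
    unfolding w' t' by (simp add: linear_simps z B_commute[of y e2 e1] algebra_simps)
  then show ?thesis by (simp add: a_b_a'_b'_def)
qed

end

section \<open>Rank two: consequences of the vanishing 3 by 3 minors\<close>

locale rank_two_family = quadratic_family g B
  for g :: "'k::field^'m::finite \<Rightarrow> 'k^'n::finite \<Rightarrow> 'k" and B +
  assumes minors: "det3 (\<lambda>t. [:g y1 t, B y1 w t:]) (\<lambda>t. [:g y2 t, B y2 w t:])
    (\<lambda>t. [:g y3 t, B y3 w t:]) t1 t2 t3 = 0"
begin

lemma gradient_expand:
  assumes "dual_pair h1 h2 e1 e2"
  shows "g y t = g y e1 * g h1 t + g y e2 * g h2 t"
  \<comment> \<open>The coefficient of s^0 does not involve the direction, so an arbitrary one is
    inserted. What remains is Cramer's rule for a dual pair.\<close>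
  using det3_pencil_eq_0(1)[OF minors[of y undefined h1 h2 e1 e2 t]] assms
  by (simp add: dual_pair_def det3_def det2_def algebra_simps)

text \<open>Coefficient of s: as the row of \<open>G\<close> starts in degree one, its Hessian row
  meets the two constant gradient rows. These form an identity matrix on \<open>e1\<close>,
  \<open>e2\<close> and vanish at \<open>u\<close>, so the determinant is the entry
  \<open>B G w u\<close>.\<close>

lemma singular_kernel:
  assumes d: "dual_pair h1 h2 e1 e2" and G: "\<And>t. g G t = 0" and u: "g h1 u = 0" "g h2 u = 0"
  shows "B G w u = 0"
  using det3_pencil_eq_0(2)[OF minors[of G w h1 h2 e1 e2 u]] d G u
  by (simp add: dual_pair_def det3_def det2_def)

text \<open>Coefficient of s^2, expanded along the row of \<open>G\<close>, whose entry at
  \<open>u\<close> is zero by \<open>singular_kernel\<close>.\<close>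

lemma singular_quadratic:
  assumes d: "dual_pair h1 h2 e1 e2" and G: "\<And>t. g G t = 0" and u: "g h1 u = 0" "g h2 u = 0"
  shows "B G w e1 * B h1 w u + B G w e2 * B h2 w u = 0"
  using det3_pencil_eq_0(3)[OF minors[of G w h1 h2 e1 e2 u]] d G u
    singular_kernel[OF d G u, of w]
  by (simp add: dual_pair_def det3_def det2_def algebra_simps add_eq_0_iff)

text \<open>Coefficient of s^3: all three rows are Hessian rows in direction \<open>w\<close>. The
  expansion is again along the row of \<open>G\<close>, which has a zero at
  \<open>u\<close>.\<close>

lemma singular_cubic:
  assumes d: "dual_pair h1 h2 e1 e2" and G: "\<And>t. g G t = 0" and u: "g h1 u = 0" "g h2 u = 0"
  shows "B G w e1 * (B h1 w e2 * B h2 w u - B h1 w u * B h2 w e2)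
    = B G w e2 * (B h1 w e1 * B h2 w u - B h1 w u * B h2 w e1)"
  using det3_pencil_eq_0(4)[OF minors[of G w h1 h2 e1 e2 u]] 
    singular_kernel[OF d G u, of w]
  by (simp add: det3_def det2_def algebra_simps)

lemma singular_expand:
  assumes d: "dual_pair h1 h2 e1 e2" and G: "\<And>t. g G t = 0"
  shows "B G w t = B G e1 e1 * (g h1 w * g h1 t)
    + B G e1 e2 * (g h1 w * g h2 t + g h2 w * g h1 t) + B G e2 e2 * (g h2 w * g h2 t)"
  by (rule dual_pair_expand[OF d singular_kernel[OF d G]])

text \<open>Here \<open>B G\<close> is a diagonal form of rank two in \<open>g h1\<close>,
  \<open>g h2\<close>. The quadratic relation kills every value of \<open>B h1\<close>,
  \<open>B h2\<close> against \<open>u\<close> except \<open>B h1 e2 u\<close> and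
  \<open>B h2 e1 u\<close>, and ties these two by a linear equation; the cubic relation shows that
  their product is zero.\<close>

lemma nondegenerate_case:
  assumes d: "dual_pair h1 h2 e1 e2" and G: "\<And>t. g G t = 0"
    and p: "B G e1 e1 \<noteq> 0" and q: "B G e1 e2 = 0" and r: "B G e2 e2 \<noteq> 0"
    and u: "g h1 u = 0" "g h2 u = 0"
  shows "B h1 w u = 0 \<and> B h2 w u = 0"
proof -
  define p r where "p = B G e1 e1" and "r = B G e2 e2"
  have pr: "p \<noteq> 0" "r \<noteq> 0" using assms p_def r_def by auto
  have G1: "B G w e1 = p * g h1 w" and G2: "B G w e2 = r * g h2 w" for w
    using d q by (simp_all add: singular_expand[OF d G, of w] p_def r_def dual_pair_def)
  have quad: "p * g h1 w * B h1 w v + r * g h2 w * B h2 w v = 0"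
    if "g h1 v = 0" "g h2 v = 0" for v w
    using singular_quadratic[OF d G that, of w] by (simp add: G1 G2)
  \<comment> \<open>\<open>quad\<close> is a quadratic identity in \<open>w\<close>; polarising it
    allows two independent directions to be inserted.\<close>
  have polar: "p * (g h1 w * B h1 w' v + g h1 w' * B h1 w v)
      + r * (g h2 w * B h2 w' v + g h2 w' * B h2 w v) = 0"
    if "g h1 v = 0" "g h2 v = 0" for v w w'
  proof -
    have "p * (g h1 w * B h1 w' v + g h1 w' * B h1 w v)
        + r * (g h2 w * B h2 w' v + g h2 w' * B h2 w v)
      = (p * g h1 (w + w') * B h1 (w + w') v + r * g h2 (w + w') * B h2 (w + w') v)
        - (p * g h1 w * B h1 w v + r * g h2 w * B h2 w v)
        - (p * g h1 w' * B h1 w' v + r * g h2 w' * B h2 w' v)"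
      by (simp add: linear_simps algebra_simps)
    then show ?thesis by (simp only: quad[OF that]) simp
  qed
  have e: "g h1 e1 = 1" "g h1 e2 = 0" "g h2 e1 = 0" "g h2 e2 = 1"
    using d by (auto simp: dual_pair_def)
  have 1: "B h1 v' v = 0 \<and> B h2 v' v = 0"
    if "g h1 v = 0" "g h2 v = 0" "g h1 v' = 0" "g h2 v' = 0" for v v'
    using polar[OF that(1,2), of v' e1] polar[OF that(1,2), of v' e2] pr that by (simp add: e)
  have 2: "B h1 e1 u = 0" "B h2 e2 u = 0"
    using quad[OF u, of e1] quad[OF u, of e2] pr by (simp_all add: e)
  have 3: "p * B h1 e2 u + r * B h2 e1 u = 0"
    using polar[OF u, of e1 e2] by (simp add: e)
  \<comment> \<open>At \<open>e2 + v\<close> the factor \<open>B G w e1\<close> vanishes and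
    \<open>B G w e2\<close> is the nonzero scalar \<open>r\<close>. By the relations found so far a
    single product survives.\<close>
  have cubic: "B h1 e2 u * B h2 (e2 + v) e1 = 0" if "g h1 v = 0" "g h2 v = 0" for v
    using singular_cubic[OF d G u, of "e2 + v"] pr that 1[OF u that] 2
    by (simp add: G1 G2 e g_add_right) (simp add: B_add_mid)
  \<comment> \<open>Taking the difference of the cases v = 0 and v = u eliminates the unknown value
    \<open>B h2 e2 e1\<close>.\<close>
  have "B h1 e2 u * B h2 e1 u = 0"
    using cubic[of 0] cubic[OF u] g_scale_right[of _ 0 0]
    by (auto simp: linear_simps B_commute[of h2 u e1] distrib_left)
  then have 4: "B h1 e2 u = 0" "B h2 e1 u = 0"
    using 3 pr by auto
  obtain v where w: "w = g h1 w *s e1 + g h2 w *s e2 + v" "g h1 v = 0" "g h2 v = 0"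
    using dual_pair_decompose[OF d] .
  show ?thesis
    by (subst (1 2) w(1)) (simp add: linear_simps 2 4 1[OF u w(2,3)])
qed

text \<open>In \<open>mixed\<close> the gradient and the Hessian share the coefficient
  \<open>q\<close>: subtracting \<open>q\<close> times \<open>h2\<close> leaves, up to a constant, a
  polynomial in the linear form \<open>g h1\<close> alone.\<close>

lemma classification:
  assumes "det2 (g y1) (g y2) t1 t2 \<noteq> 0"
  obtains (span) h1 h2 where
      "\<And>y. \<exists>p q. (\<forall>t. g y t = p * g h1 t + q * g h2 t) \<and>
         (\<forall>w t. B y w t = p * B h1 w t + q * B h2 w t)"
  | (plane) h1 h2 where
      "\<And>y. \<exists>p q. \<forall>t. g y t = p * g h1 t + q * g h2 t"
      "\<And>y. \<exists>p q r. \<forall>w t. B y w t = p * (g h1 w * g h1 t)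
         + q * (g h1 w * g h2 t + g h2 w * g h1 t) + r * (g h2 w * g h2 t)"
  | (mixed) h1 h2 where
      "\<And>y. \<exists>p q r. (\<forall>t. g y t = p * g h1 t + q * g h2 t) \<and>
         (\<forall>w t. B y w t = q * B h2 w t + r * (g h1 w * g h1 t))"
proof -
  obtain h1 h2 where d0: "dual_pair h1 h2 t1 t2"
    using dual_pair_exists[OF assms] .
  show ?thesis
  proof (cases "\<forall>y. (\<forall>t. g y t = 0) \<longrightarrow> (\<forall>w t. B y w t = 0)")
    case True
    show ?thesis
    proof (rule span[of h1 h2])
      fix y
      let ?z = "y - g y t1 *s h1 - g y t2 *s h2"
      have *: "g ?z t = 0" for t
        using gradient_expand[OF d0, of y t] by (simp add: linear_simps)
      have "B y w t = g y t1 * B h1 w t + g y t2 * B h2 w t" for w t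
        using True[rule_format, of ?z w t, OF *] by (simp add: linear_simps algebra_simps)
      with gradient_expand[OF d0, of y] show "\<exists>p q. (\<forall>t. g y t = p * g h1 t + q * g h2 t) \<and>
         (\<forall>w t. B y w t = p * B h1 w t + q * B h2 w t)"
        by blast
    qed
  next
    case False
    then obtain G where G: "\<And>t. g G t = 0" and "\<exists>w t. B G w t \<noteq> 0" by blast
    then obtain e1 where p: "B G e1 e1 \<noteq> 0" using B_nonzero_diag by blast
    \<comment> \<open>A vector on which \<open>B G\<close> is nonzero cannot lie in the common
      kernel, so it can be completed by \<open>t1\<close> or \<open>t2\<close> to a pair with
      nonzero minor.\<close>
    have "\<not> (g h1 e1 = 0 \<and> g h2 e1 = 0)"
      using singular_kernel[OF d0 G] p by blast
    then have "det2 (g h1) (g h2) e1 t1 \<noteq> 0 \<or> det2 (g h1) (g h2) e1 t2 \<noteq> 0"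
      using d0 by (auto simp: dual_pair_def det2_def)
    then obtain t where t: "det2 (g h1) (g h2) e1 t \<noteq> 0" by blast
    \<comment> \<open>Gram-Schmidt with respect to \<open>B G\<close>: the new pair diagonalises the
      Hessian of \<open>G\<close>, while the minor keeps its value.\<close>
    define e2 where "e2 = t - (B G e1 t / B G e1 e1) *s e1"
    have q: "B G e1 e2 = 0" using p by (simp add: e2_def linear_simps)
    have "det2 (g h1) (g h2) e1 e2 = det2 (g h1) (g h2) e1 t"
      by (simp add: e2_def det2_def linear_simps algebra_simps)
    then obtain h1 h2 where d: "dual_pair h1 h2 e1 e2"
      using dual_pair_exists t by metis
    then have e: "g h1 e1 = 1" "g h1 e2 = 0" "g h2 e1 = 0" "g h2 e2 = 1"
      by (auto simp: dual_pair_def)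
    have g_exp: "\<exists>p q. \<forall>t. g y t = p * g h1 t + q * g h2 t" for y
      by (intro exI allI) (rule gradient_expand[OF d])
    \<comment> \<open>Checking \<open>h1\<close> and \<open>h2\<close> suffices: every
      \<open>y\<close> differs from a combination of them by a singular element, to which
      \<open>singular_kernel\<close> applies.\<close>
    have planeI: thesis
      if h12: "\<And>w u. g h1 u = 0 \<Longrightarrow> g h2 u = 0 \<Longrightarrow> B h1 w u = 0 \<and> B h2 w u = 0"
    proof (rule plane[of h1 h2])
      fix y
      let ?z = "y - g y e1 *s h1 - g y e2 *s h2"
      have *: "g ?z t = 0" for t
        using gradient_expand[OF d, of y t] by (simp add: linear_simps)
      have "B y w u = 0" if "g h1 u = 0" "g h2 u = 0" for w u
        using singular_kernel[OF d * that] h12[OF that]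
        by (simp add: linear_simps)
      then show "\<exists>p q r. \<forall>w t. B y w t = p * (g h1 w * g h1 t)
         + q * (g h1 w * g h2 t + g h2 w * g h1 t) + r * (g h2 w * g h2 t)"
        by (intro exI allI) (rule dual_pair_expand[OF d])
    qed (rule g_exp)
    have planeI': thesis if h1: "\<And>w u. g h1 u = 0 \<Longrightarrow> g h2 u = 0 \<Longrightarrow> B h1 w u = 0"
      and h2: "\<And>u w. g h1 u = 0 \<Longrightarrow> g h2 u = 0 \<Longrightarrow> B h2 w u = 0"
      by (rule planeI) (use h1 h2 in simp)
    show ?thesis
    proof (cases "B G e2 e2 = 0")
      case False
      show ?thesis
        by (rule planeI) (rule nondegenerate_case[OF d G p q False])
    next
      case r: True
      \<comment> \<open>From here on the Hessian of \<open>G\<close> is a multiple of the square of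
        \<open>g h1\<close>, so the relations constrain \<open>h1\<close> first and
        \<open>h2\<close> only through further case distinctions.\<close>
      have G1: "B G w e1 = B G e1 e1 * g h1 w" and G2: "B G w e2 = 0" for w
        using q r by (simp_all add: singular_expand[OF d G, of w] e)
      have quad: "g h1 w * B h1 w u = 0" if "g h1 u = 0" "g h2 u = 0" for u w
        using singular_quadratic[OF d G that, of w] p by (simp add: G1[of w] G2)
      have h1: "B h1 w u = 0" if u: "g h1 u = 0" "g h2 u = 0" for u w
      proof (cases "g h1 w = 0")
        case True
        \<comment> \<open>The factor \<open>g h1\<close> equals 1 at both \<open>w + e1\<close> and
          \<open>e1\<close>, so \<open>quad\<close> gives zero at each, and additivity gives zero at
          \<open>w\<close>.\<close>
        then show ?thesis
          using quad[OF u, of "w + e1"] quad[OF u, of e1] by (simp add: linear_simps e)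
      qed (use quad[OF u, of w] in simp)
      have h1_exp: "B h1 w t = B h1 e1 e1 * (g h1 w * g h1 t)
          + B h1 e1 e2 * (g h1 w * g h2 t + g h2 w * g h1 t) + B h1 e2 e2 * (g h2 w * g h2 t)" for w t
        by (rule dual_pair_expand[OF d h1])
      have cubic: "g h1 w * B h1 w e2 * B h2 w u = 0" if u: "g h1 u = 0" "g h2 u = 0" for u w
        using singular_cubic[OF d G u, of w] p h1[OF u] by (simp add: G1[of w] G2)
      show ?thesis
      proof (cases "B h1 e1 e2 = 0 \<and> B h1 e2 e2 = 0")
        case False
        \<comment> \<open>\<open>?l k\<close> is \<open>B h1 (e1 + k *s e2) e2\<close>. A nonzero
          affine function has at most one root, so two of the three distinct scalars 0, 1, -1 avoid
          it; this works over the field of three elements as well.\<close>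
        let ?l = "\<lambda>k. B h1 e1 e2 + k * B h1 e2 e2"
        have ne: "(1::'k) \<noteq> - 1" using two by (simp add: eq_neg_iff_add_eq_0)
        have "\<exists>k k'. k \<noteq> k' \<and> ?l k \<noteq> 0 \<and> ?l k' \<noteq> 0"
        proof (cases "?l 0 = 0")
          case True
          then show ?thesis using False ne by (intro exI[of _ 1] exI[of _ "-1"]) auto
        next
          case l0: False
          show ?thesis
          proof (cases "?l 1 = 0")
            case True
            then have "?l (-1) = 2 * ?l 0" by (simp add: add_eq_0_iff)
            then show ?thesis
              using l0 two by (intro exI[of _ "0"] exI[of _ "-1"]) auto
          next
            case False
            then show ?thesis using l0 by (intro exI[of _ "0"] exI[of _ "1"]) auto
          qed
        qed
        then obtain k k' where k: "k \<noteq> k'" "?l k \<noteq> 0" "?l k' \<noteq> 0" by blast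
        show ?thesis
        proof (rule planeI'[OF h1])
          fix u w assume u: "g h1 u = 0" "g h2 u = 0"
          \<comment> \<open>On such vectors \<open>g h1\<close> is 1 and \<open>B h1\<close> against
            \<open>e2\<close> is \<open>?l c\<close>, so the cubic relation leaves only the factor
            with \<open>B h2\<close>. Two values of \<open>c\<close> then separate \<open>e1\<close>
            from \<open>e2\<close>.\<close>
          have *: "B h2 (e1 + c *s e2 + v) u = 0"
            if v: "g h1 v = 0" "g h2 v = 0" and c: "?l c \<noteq> 0" for v c
          proof -
            have "B h1 v e2 = 0" using h1[OF v] by (simp add: B_commute[of h1 v])
            then show ?thesis
              using cubic[OF u, of "e1 + c *s e2 + v"] c v by (simp add: linear_simps e)
          qed
          have z: "g h1 0 = 0" "g h2 0 = 0" "B h2 0 u = 0"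
            using g_scale_right[of _ 0 0] B_scale_mid[of _ 0 0] by auto
          have 1: "B h2 e1 u + k * B h2 e2 u = 0" "B h2 e1 u + k' * B h2 e2 u = 0"
            using *[of 0 k] *[of 0 k'] k z by (simp_all add: linear_simps)
          have "(k - k') * B h2 e2 u = (B h2 e1 u + k * B h2 e2 u) - (B h2 e1 u + k' * B h2 e2 u)"
            by (simp add: algebra_simps)
          then have "(k - k') * B h2 e2 u = 0" by (simp only: 1) simp
          then have 2: "B h2 e2 u = 0" "B h2 e1 u = 0" using k 1 by auto
          have 3: "B h2 v u = 0" if v: "g h1 v = 0" "g h2 v = 0" for v
            using *[OF v k(2)] 2 by (simp add: linear_simps)
          obtain v where w: "w = g h1 w *s e1 + g h2 w *s e2 + v" "g h1 v = 0" "g h2 v = 0"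
            using dual_pair_decompose[OF d] .
          show "B h2 w u = 0"
            by (subst w(1)) (simp add: linear_simps 2 3 w(2,3))
        qed
      next
        case True
        then have B_h1: "B h1 w t = B h1 e1 e1 * (g h1 w * g h1 t)" for w t
          by (simp add: h1_exp[of w t])
        have B_G: "B G w t = B G e1 e1 * (g h1 w * g h1 t)" for w t
          using q r by (simp add: singular_expand[OF d G, of w t])
        show ?thesis
        proof (cases "\<forall>F. (\<forall>t. g F t = 0) \<longrightarrow> B F e1 e2 = 0 \<and> B F e2 e2 = 0")
          case True
          show ?thesis
          proof (rule mixed[of h1 h2])
            fix y
            let ?z = "y - g y e1 *s h1 - g y e2 *s h2"
            have *: "g ?z t = 0" for t
              using gradient_expand[OF d, of y t] by (simp add: linear_simps)
            have "B y w t = g y e2 * B h2 w t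
                + (B ?z e1 e1 + g y e1 * B h1 e1 e1) * (g h1 w * g h1 t)" for w t
              using True[rule_format, OF *] singular_expand[OF d *, of w t] B_h1[of w t]
              by (simp add: linear_simps algebra_simps)
            then show "\<exists>p q r. (\<forall>t. g y t = p * g h1 t + q * g h2 t) \<and>
               (\<forall>w t. B y w t = q * B h2 w t + r * (g h1 w * g h1 t))"
              by (intro exI conjI allI) (rule gradient_expand[OF d])
          qed
        next
          case False
          then obtain F where F: "\<And>t. g F t = 0" and F': "B F e1 e2 \<noteq> 0 \<or> B F e2 e2 \<noteq> 0"
            by blast
          \<comment> \<open>The Hessians of \<open>h1\<close> and \<open>G\<close> are multiples of
            the same square. Subtracting the right multiple of \<open>G\<close> keeps the
            differential and removes the Hessian, so the first term of the quadratic relation for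
            \<open>F\<close> drops out.\<close>
          define h where "h = h1 - (B h1 e1 e1 / B G e1 e1) *s G"
          have g_h: "g h t = g h1 t" for t by (simp add: h_def linear_simps G)
          have B_h: "B h w t = 0" for w t
            using p by (simp add: h_def linear_simps B_h1[of w t] B_G[of w t])
          have d': "dual_pair h h2 e1 e2" using d by (simp add: dual_pair_def g_h)
          show ?thesis
          proof (rule planeI'[OF h1])
            fix u w assume u: "g h1 u = 0" "g h2 u = 0"
            have *: "B F w e2 * B h2 w u = 0" for w
              using singular_quadratic[OF d' F, of u w] u by (simp add: g_h B_h)
            obtain w0 where w0: "B F w0 e2 \<noteq> 0" using F' by blast
            show "B h2 w u = 0"
            proof (cases "B F w e2 = 0")
              case True
              \<comment> \<open>A product of two linear functions of \<open>w\<close> is zero and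
                the first is nonzero at \<open>w0\<close>: evaluating at \<open>w0\<close> and at
                \<open>w + w0\<close> shows that the second vanishes at \<open>w\<close>.\<close>
              then show ?thesis using *[of "w + w0"] *[of w0] w0 by (simp add: linear_simps)
            qed (use *[of w] in simp)
          qed
        qed
      qed
    qed
  qed
qed

end

section \<open>Rank one: consequences of the vanishing 2 by 2 minors\<close>

locale rank_one_family = quadratic_family g B
  for g :: "'k::field^'m::finite \<Rightarrow> 'k^'n::finite \<Rightarrow> 'k" and B +
  assumes minors: "det2 (\<lambda>t. [:g y1 t, B y1 w t:]) (\<lambda>t. [:g y2 t, B y2 w t:]) t1 t2 = 0"
begin

text \<open>The scheme of rank two with a simpler outcome: once a singular \<open>G\<close> is a
  multiple of the square of \<open>g h\<close>, the coefficient of s^2 forces the same shape on the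
  Hessian of \<open>h\<close>, so no mixed case arises.\<close>

lemma classification:
  assumes "g y0 t0 \<noteq> 0"
  obtains (span) h where
      "\<And>y. \<exists>p. (\<forall>t. g y t = p * g h t) \<and> (\<forall>w t. B y w t = p * B h w t)"
  | (line) h where
      "\<And>y. \<exists>p. \<forall>t. g y t = p * g h t" "\<And>y. \<exists>p. \<forall>w t. B y w t = p * (g h w * g h t)"
proof -
  have normalise: "\<exists>h. g h e = 1" if "g y0 e \<noteq> 0" for e
    using that by (intro exI[of _ "(1 / g y0 e) *s y0"]) (simp add: linear_simps)
  have g_exp: "g y t = g y e * g h t" if "g h e = 1" for h e y t
    using det2_pencil_eq_0(1)[OF minors[of y undefined h e t]] that by (simp add: det2_def)
  have kernel: "B G w u = 0" if "g h e = 1" "\<And>t. g G t = 0" "g h u = 0" for h e G u w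
    using det2_pencil_eq_0(2)[OF minors[of h w G e u]] that by (simp add: det2_def)
  obtain h where h: "g h t0 = 1" using normalise[OF assms] by blast
  show ?thesis
  proof (cases "\<forall>y. (\<forall>t. g y t = 0) \<longrightarrow> (\<forall>w t. B y w t = 0)")
    case True
    show ?thesis
    proof (rule span[of h])
      fix y
      let ?z = "y - g y t0 *s h"
      have *: "g ?z t = 0" for t
        using g_exp[OF h, of y t] by (simp add: linear_simps)
      have "B y w t = g y t0 * B h w t" for w t
        using True[rule_format, of ?z w t, OF *] by (simp add: linear_simps)
      with g_exp[OF h, of y] show "\<exists>p. (\<forall>t. g y t = p * g h t) \<and> (\<forall>w t. B y w t = p * B h w t)"
        by blast
    qed
  next
    case False
    then obtain G where G: "\<And>t. g G t = 0" and "\<exists>w t. B G w t \<noteq> 0" by blast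
    then obtain e where p: "B G e e \<noteq> 0" using B_nonzero_diag by blast
    \<comment> \<open>Otherwise \<open>e\<close> would be in the kernel of the gradients and
      \<open>B G e e\<close> would vanish. Hence \<open>h\<close> can be renormalised at
      \<open>e\<close> instead of \<open>t0\<close>.\<close>
    have "g y0 e \<noteq> 0" using kernel[OF h G] p g_exp[OF h, of y0 e] assms by fastforce
    then obtain h where h: "g h e = 1" using normalise by blast
    have G1: "B G w e = B G e e * g h w" for w
    proof -
      have "B G e (w - g h w *s e) = 0"
        by (rule kernel[OF h G]) (simp add: linear_simps h)
      then show ?thesis by (simp add: linear_simps B_commute[of G w e])
    qed
    have h_quad: "g h w * B h w u = 0" if "g h u = 0" for u w
      using det2_pencil_eq_0(3)[OF minors[of G w h e u]] that p G1[of w] kernel[OF h G that]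
      by (simp add: det2_def)
    have h_ker: "B h w u = 0" if u: "g h u = 0" for u w
    proof (cases "g h w = 0")
      case True
      then show ?thesis
        using h_quad[OF u, of "w + e"] h_quad[OF u, of e] by (simp add: linear_simps h)
    qed (use h_quad[OF u, of w] in simp)
    show ?thesis
    proof (rule line[of h])
      fix y
      have y_ker: "B y w u = 0" if u: "g h u = 0" for u w
      proof -
        have "g (y - g y e *s h) t = 0" for t
          using g_exp[OF h, of y t] by (simp add: linear_simps)
        then have "B (y - g y e *s h) w u = 0"
          by (rule kernel[OF h _ u])
        then show ?thesis by (simp add: linear_simps h_ker[OF u])
      qed
      have "B y w t = B y e e * (g h w * g h t)" for w t
      proof -
        have "B y w (t - g h t *s e) = 0" "B y e (w - g h w *s e) = 0"
          by (rule y_ker; simp add: linear_simps h)+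
        then show ?thesis by (simp add: linear_simps B_commute[of y w e])
      qed
      then show "\<exists>p. \<forall>w t. B y w t = p * (g h w * g h t)" by blast
    qed (use g_exp[OF h] in blast)
  qed
qed

end

section \<open>Polynomial evaluation and differentiation\<close>

text \<open>The index set is counted, not the image: a repeated vector already gives a relation,
  with coefficients 1 and -1.\<close>

lemma (in vector_space) family_dependent:
  assumes "finite I" "finite T" "f ` I \<subseteq> span T" "card T < card I"
  obtains c i where "i \<in> I" "c i \<noteq> 0" "(\<Sum>i\<in>I. scale (c i) (f i)) = 0"
proof (cases "inj_on f I")
  case True
  have "dependent (f ` I)"
    using independent_span_bound[of T "f ` I"] assms card_image[OF True] by auto
  then obtain u v where u: "v \<in> f ` I" "u v \<noteq> 0" "(\<Sum>v\<in>f ` I. scale (u v) v) = 0"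
    using dependent_finite[of "f ` I"] assms(1) by auto
  then obtain i where "i \<in> I" "u (f i) \<noteq> 0" by blast
  moreover have "(\<Sum>i\<in>I. scale (u (f i)) (f i)) = 0"
    using u(3) by (simp add: sum.reindex[OF True])
  ultimately show ?thesis using that[of i "u \<circ> f"] by simp
next
  case False
  then obtain i j where ij: "i \<in> I" "j \<in> I" "i \<noteq> j" "f i = f j"
    by (auto simp: inj_on_def)
  define c where "c = (\<lambda>k. if k = i then 1 else if k = j then - 1 else 0 :: 'a)"
  have "(\<Sum>k\<in>I. scale (c k) (f k)) = (\<Sum>k\<in>{i, j}. scale (c k) (f k))"
    using assms(1) ij by (intro sum.mono_neutral_right) (auto simp: c_def)
  also have "\<dots> = 0" using ij by (simp add: c_def)
  finally show ?thesis using that[of i c] ij by (simp add: c_def)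
qed

lemma mconst_0 [simp]: "mconst 0 = 0"
  and mconst_1 [simp]: "mconst 1 = 1"
  by (simp_all add: mconst_def)

lemma mconst_add: "mconst (c + d) = mconst c + mconst d"
  by (simp add: mconst_def single_add)

lemma mconst_uminus: "mconst (- c) = - mconst (c::'k::comm_ring_1)"
  by (simp add: mconst_def single_uminus)

lemma mconst_diff: "mconst (c - d) = mconst c - mconst (d::'k::comm_ring_1)"
  by (simp add: mconst_def single_diff)

lemma mconst_mult: "mconst (c * d) = mconst c * mconst (d::'k::comm_ring_1)"
  by (simp add: mconst_def mult_single)

lemma mconst_sum: "mconst (sum f A) = (\<Sum>i\<in>A. mconst (f i))"
  by (induction A rule: infinite_finite_induct) (simp_all add: mconst_add)

definition mvar :: "'n \<Rightarrow> ('n, 'k::comm_ring_1) mpoly"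
  where "mvar j = Poly_Mapping.single (Poly_Mapping.single j 1) 1"

lemma poly_mapping_eq_sum_single:
  "p = (\<Sum>e\<in>Poly_Mapping.keys p. Poly_Mapping.single e (Poly_Mapping.lookup p e))"
  by (rule poly_mapping_eqI)
    (simp add: lookup_sum lookup_single when_def in_keys_iff)

definition meval_monom :: "('v \<Rightarrow> 'l::comm_semiring_1) \<Rightarrow> ('v \<Rightarrow>\<^sub>0 nat) \<Rightarrow> 'l"
  where "meval_monom a e = (\<Prod>v\<in>Poly_Mapping.keys e. a v ^ Poly_Mapping.lookup e v)"

lemma meval_monom_superset:
  assumes "finite V" "Poly_Mapping.keys e \<subseteq> V"
  shows "meval_monom a e = (\<Prod>v\<in>V. a v ^ Poly_Mapping.lookup e v)"
  unfolding meval_monom_def using assms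
  by (intro prod.mono_neutral_left) (auto simp: in_keys_iff)

lemma meval_monom_add: "meval_monom a (e + e') = meval_monom a e * meval_monom a e'"
proof -
  let ?V = "Poly_Mapping.keys e \<union> Poly_Mapping.keys e'"
  have "Poly_Mapping.keys (e + e') \<subseteq> ?V" by (rule keys_add)
  then show ?thesis
    by (simp add: meval_monom_superset[of ?V] lookup_add power_add prod.distrib)
qed

text \<open>Three instances occur: the identity for values at points, constant univariate
  polynomials for substituting lines and curves, and \<open>ratconst\<close> for relations between
  rational functions.\<close>

locale coefficient_hom =
  fixes \<iota> :: "'k::comm_ring_1 \<Rightarrow> 'l::comm_ring_1"
  assumes hom_1: "\<iota> 1 = 1"
    and hom_add: "\<iota> (x + y) = \<iota> x + \<iota> y"
    and hom_mult: "\<iota> (x * y) = \<iota> x * \<iota> y"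
begin

lemma hom_0: "\<iota> 0 = 0"
  using hom_add[of 0 0] by simp

lemma mpoly_eval_superset:
  assumes "finite A" "Poly_Mapping.keys p \<subseteq> A"
  shows "mpoly_eval \<iota> a p = (\<Sum>e\<in>A. \<iota> (Poly_Mapping.lookup p e) * meval_monom a e)"
  unfolding mpoly_eval_def meval_monom_def[symmetric] using assms
  by (intro sum.mono_neutral_left) (auto simp: in_keys_iff hom_0)

lemma mpoly_eval_add: "mpoly_eval \<iota> a (p + q) = mpoly_eval \<iota> a p + mpoly_eval \<iota> a q"
proof -
  let ?A = "Poly_Mapping.keys p \<union> Poly_Mapping.keys q"
  have "Poly_Mapping.keys (p + q) \<subseteq> ?A" by (rule keys_add)
  then show ?thesis
    by (simp add: mpoly_eval_superset[of ?A] lookup_add hom_add distrib_right sum.distrib)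
qed

lemma mpoly_eval_0 [simp]: "mpoly_eval \<iota> a 0 = 0"
  by (simp add: mpoly_eval_def)

lemma mpoly_eval_sum: "mpoly_eval \<iota> a (sum f A) = (\<Sum>i\<in>A. mpoly_eval \<iota> a (f i))"
  by (induction A rule: infinite_finite_induct) (simp_all add: mpoly_eval_add)

lemma mpoly_eval_single: "mpoly_eval \<iota> a (Poly_Mapping.single e c) = \<iota> c * meval_monom a e"
  by (subst mpoly_eval_superset[of "{e}"]) simp_all

lemma mpoly_eval_mult: "mpoly_eval \<iota> a (p * q) = mpoly_eval \<iota> a p * mpoly_eval \<iota> a q"
proof -
  have "p * q = (\<Sum>e\<in>Poly_Mapping.keys p. \<Sum>e'\<in>Poly_Mapping.keys q.
      Poly_Mapping.single (e + e') (Poly_Mapping.lookup p e * Poly_Mapping.lookup q e'))"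
    by (subst poly_mapping_eq_sum_single[of p], subst poly_mapping_eq_sum_single[of q])
      (simp add: sum_product mult_single)
  then show ?thesis
    by (simp add: mpoly_eval_sum mpoly_eval_single hom_mult meval_monom_add
        mpoly_eval_superset[of "Poly_Mapping.keys p" p] mpoly_eval_superset[of "Poly_Mapping.keys q" q]
        sum_product mult_ac)
qed

lemma mpoly_eval_mconst [simp]: "mpoly_eval \<iota> a (mconst c) = \<iota> c"
  by (simp add: mconst_def mpoly_eval_single meval_monom_def)

lemma mpoly_eval_mvar [simp]: "mpoly_eval \<iota> a (mvar j) = a j"
  by (simp add: mvar_def mpoly_eval_single meval_monom_def hom_1)

lemma mpoly_eval_1 [simp]: "mpoly_eval \<iota> a 1 = 1"
  using mpoly_eval_mconst[of a 1] by (simp add: hom_1)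

lemma mpoly_eval_uminus: "mpoly_eval \<iota> a (- p) = - mpoly_eval \<iota> a p"
  using mpoly_eval_add[of a p "- p"] by (simp add: eq_neg_iff_add_eq_0 add.commute)

lemma mpoly_eval_diff: "mpoly_eval \<iota> a (p - q) = mpoly_eval \<iota> a p - mpoly_eval \<iota> a q"
  using mpoly_eval_add[of a p "- q"] by (simp add: mpoly_eval_uminus)

lemma mpoly_eval_power: "mpoly_eval \<iota> a (p ^ n) = mpoly_eval \<iota> a p ^ n"
  by (induction n) (simp_all add: mpoly_eval_mult)

end

interpretation id_hom: coefficient_hom "\<lambda>c::'k::comm_ring_1. c"
  by unfold_locales simp_all

interpretation const_poly_hom: coefficient_hom "\<lambda>c::'k::comm_ring_1. [:c:]"
  by unfold_locales simp_all

lemma to_mratfun_0 [simp]: "to_mratfun 0 = 0"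
  and to_mratfun_1 [simp]: "to_mratfun 1 = 1"
  by (simp_all add: to_mratfun_def Zero_fract_def One_fract_def)

lemma to_mratfun_add: "to_mratfun (p + q) = to_mratfun p + to_mratfun q"
  and to_mratfun_mult: "to_mratfun (p * q) = to_mratfun p * to_mratfun q"
  and to_mratfun_diff: "to_mratfun (p - q) = to_mratfun p - to_mratfun q"
  by (simp_all add: to_mratfun_def)

lemma to_mratfun_sum: "to_mratfun (sum f A) = (\<Sum>i\<in>A. to_mratfun (f i))"
  by (induction A rule: infinite_finite_induct) (simp_all add: to_mratfun_add)

lemma to_mratfun_power: "to_mratfun (p ^ n) = to_mratfun p ^ n"
  by (induction n) (simp_all add: to_mratfun_mult)

lemma to_mratfun_eq_iff [simp]: "to_mratfun p = to_mratfun q \<longleftrightarrow> p = q"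
  by (simp add: to_mratfun_def eq_fract)

lemma to_mratfun_eq_0_iff [simp]: "to_mratfun p = 0 \<longleftrightarrow> p = 0"
  using to_mratfun_eq_iff[of p 0] by (simp del: to_mratfun_eq_iff)

interpretation ratconst_hom: coefficient_hom
  "ratconst :: 'k::field \<Rightarrow> ('n::linorder, 'k) mratfun"
  by unfold_locales (simp_all add: ratconst_def mconst_add mconst_mult to_mratfun_add to_mratfun_mult)

section \<open>Normal form of polynomials of degree at most two\<close>

definition affine_mpoly :: "'k \<Rightarrow> ('n::finite \<Rightarrow> 'k) \<Rightarrow> ('n, 'k::comm_ring_1) mpoly"
  where "affine_mpoly c b = mconst c + (\<Sum>j\<in>UNIV. mconst (b j) * mvar j)"

text \<open>\<open>A\<close> need not be symmetric. The coefficients are then not unique, but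
  monomials and products of affine polynomials fit in without division by two.\<close>

definition quadratic_mpoly ::
  "'k \<Rightarrow> ('n::finite \<Rightarrow> 'k) \<Rightarrow> ('n \<Rightarrow> 'n \<Rightarrow> 'k) \<Rightarrow> ('n, 'k::comm_ring_1) mpoly"
  where "quadratic_mpoly c b A = affine_mpoly c b
    + (\<Sum>j\<in>UNIV. \<Sum>k\<in>UNIV. mconst (A j k) * (mvar j * mvar k))"

lemma quadratic_mpoly_add:
  "quadratic_mpoly c b A + quadratic_mpoly c' b' A'
    = quadratic_mpoly (c + c') (\<lambda>j. b j + b' j) (\<lambda>j k. A j k + A' j k)"
  by (simp add: quadratic_mpoly_def affine_mpoly_def mconst_add distrib_right sum.distrib)

lemma quadratic_mpoly_diff:
  "quadratic_mpoly c b A - quadratic_mpoly c' b' A'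
    = quadratic_mpoly (c - c') (\<lambda>j. b j - b' j) (\<lambda>j k. A j k - A' j k)"
  by (simp add: quadratic_mpoly_def affine_mpoly_def mconst_diff left_diff_distrib sum_subtractf)

lemma affine_mpoly_mult:
  "affine_mpoly c b * affine_mpoly c' b'
    = quadratic_mpoly (c * c') (\<lambda>j. c * b' j + c' * b j) (\<lambda>j k. b j * b' k)"
  by (simp add: quadratic_mpoly_def affine_mpoly_def mconst_add mconst_mult distrib_left
      distrib_right sum.distrib sum_product sum_distrib_left sum_distrib_right mult_ac add_ac)
    (subst sum.swap, simp add: mult_ac)

lemma monom_degree_superset:
  assumes "finite V" "Poly_Mapping.keys e \<subseteq> V"
  shows "monom_degree e = (\<Sum>i\<in>V. Poly_Mapping.lookup e i)"
  unfolding monom_degree_def using assms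
  by (intro sum.mono_neutral_left) (auto simp: in_keys_iff)

lemma monom_degree_add: "monom_degree (e + e') = monom_degree e + monom_degree e'"
proof -
  let ?V = "Poly_Mapping.keys e \<union> Poly_Mapping.keys e'"
  have "Poly_Mapping.keys (e + e') \<subseteq> ?V" by (rule keys_add)
  then show ?thesis
    by (simp add: monom_degree_superset[of ?V] lookup_add sum.distrib)
qed

lemma monom_degree_Suc_split:
  assumes "monom_degree e > 0"
  obtains j e' where "e = Poly_Mapping.single j 1 + e'" "monom_degree e = Suc (monom_degree e')"
proof -
  from assms obtain j where j: "Poly_Mapping.lookup e j > 0"
    unfolding monom_degree_def by (metis gr_zeroI less_numeral_extra(3) sum.neutral)
  have e: "e = Poly_Mapping.single j 1 + (e - Poly_Mapping.single j 1)"
    by (rule poly_mapping_eqI) (use j in \<open>auto simp: lookup_add lookup_minus lookup_single when_def\<close>)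
  moreover have "monom_degree (Poly_Mapping.single j 1 :: _ \<Rightarrow>\<^sub>0 nat) = 1"
    by (simp add: monom_degree_def)
  ultimately show ?thesis
    using that[of j "e - Poly_Mapping.single j 1"] monom_degree_add by (metis plus_1_eq_Suc)
qed

lemma monom_degree_eq_0_iff: "monom_degree e = 0 \<longleftrightarrow> e = 0"
  by (auto simp: monom_degree_def in_keys_iff intro!: poly_mapping_eqI)

lemma sum_delta_mult: "(\<Sum>k\<in>UNIV. mconst (if k = j then c else 0) * f k) = mconst c * f (j::'n::finite)"
proof -
  have "(\<Sum>k\<in>UNIV. mconst (if k = j then c else 0) * f k) = (\<Sum>k\<in>UNIV. if k = j then mconst c * f k else 0)"
    by (rule sum.cong) auto
  then show ?thesis by simp
qed

lemma single_quadratic_mpoly: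
  assumes "monom_degree e \<le> 2"
  shows "\<exists>c b A. Poly_Mapping.single e d = (quadratic_mpoly c b A :: ('n::finite, 'k::comm_ring_1) mpoly)"
proof (cases "monom_degree e = 0")
  case True
  then have "Poly_Mapping.single e d = quadratic_mpoly d (\<lambda>_. 0) (\<lambda>_ _. 0)"
    by (simp add: monom_degree_eq_0_iff quadratic_mpoly_def affine_mpoly_def mconst_def)
  then show ?thesis by blast
next
  case False
  then obtain j e' where e: "e = Poly_Mapping.single j 1 + e'" "monom_degree e = Suc (monom_degree e')"
    using monom_degree_Suc_split by (metis gr0I)
  show ?thesis
  proof (cases "monom_degree e' = 0")
    case True
    then have "Poly_Mapping.single e d = mconst d * mvar j"
      unfolding e(1) by (simp add: monom_degree_eq_0_iff mult_single mconst_def mvar_def)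
    also have "\<dots> = quadratic_mpoly 0 (\<lambda>k. if k = j then d else 0) (\<lambda>_ _. 0)"
      by (simp add: quadratic_mpoly_def affine_mpoly_def sum_delta_mult)
    finally show ?thesis by blast
  next
    case False
    then obtain l e'' where e': "e' = Poly_Mapping.single l 1 + e''" "monom_degree e' = Suc (monom_degree e'')"
      using monom_degree_Suc_split by (metis gr0I)
    then have "e'' = 0" using e assms by (simp add: monom_degree_eq_0_iff)
    then have "Poly_Mapping.single e d = mconst d * (mvar j * mvar l)"
      unfolding e(1) e'(1) by (simp add: mult_single mconst_def mvar_def)
    also have "\<dots> = quadratic_mpoly 0 (\<lambda>_. 0) (\<lambda>k. if k = j then (\<lambda>m. if m = l then d else 0) else (\<lambda>_. 0))"
    proof -
      have "(\<Sum>m\<in>UNIV. mconst ((if k = j then (\<lambda>m. if m = l then d else 0) else (\<lambda>_. 0)) m) * (mvar k * mvar m))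
        = mconst (if k = j then d else 0) * (mvar k * mvar l)" for k
        by (cases "k = j") (simp_all add: sum_delta_mult)
      then show ?thesis
        by (simp add: quadratic_mpoly_def affine_mpoly_def sum_delta_mult)
    qed
    finally show ?thesis by blast
  qed
qed

lemma total_degree_le_2_quadratic_mpoly:
  fixes p :: "('n::finite, 'k::comm_ring_1) mpoly"
  assumes "total_degree p \<le> 2"
  shows "\<exists>c b A. p = quadratic_mpoly c b A"
proof -
  have "\<exists>c b A. (\<Sum>e\<in>F. Poly_Mapping.single e (Poly_Mapping.lookup p e)) = quadratic_mpoly c b A"
    if "finite F" "F \<subseteq> Poly_Mapping.keys p" for F
    using that
  proof (induction F)
    case empty
    have "0 = (quadratic_mpoly 0 (\<lambda>_. 0) (\<lambda>_ _. 0) :: ('n, 'k) mpoly)"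
      by (simp add: quadratic_mpoly_def affine_mpoly_def)
    then show ?case by (metis sum.empty)
  next
    case (insert e F)
    have "monom_degree e \<le> total_degree p"
      unfolding total_degree_def using insert.prems by (intro Max_ge) auto
    then have "\<exists>c b A. Poly_Mapping.single e (Poly_Mapping.lookup p e) = quadratic_mpoly c b A"
      using assms by (intro single_quadratic_mpoly) simp
    with insert show ?case by (auto simp: quadratic_mpoly_add) (metis)
  qed
  from this[OF finite_keys order_refl] show ?thesis
    using poly_mapping_eq_sum_single[of p] by metis
qed

lemma mpoly_eval_quadratic_mpoly:
  assumes "coefficient_hom \<iota>"
  shows "mpoly_eval \<iota> a (quadratic_mpoly c b A) = \<iota> c + (\<Sum>j\<in>UNIV. \<iota> (b j) * a j)
    + (\<Sum>j\<in>UNIV. \<Sum>k\<in>UNIV. \<iota> (A j k) * (a j * a k))"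
proof -
  interpret coefficient_hom \<iota> by fact
  show ?thesis
    by (simp add: quadratic_mpoly_def affine_mpoly_def mpoly_eval_add mpoly_eval_sum mpoly_eval_mult)
qed

text \<open>The coefficients are recovered from the values at \<open>\<plusminus>x\<close>, at unit vectors and at sums of two
  unit vectors, so this holds over the field of three elements as well.\<close>

lemma quadratic_mpoly_eq_0_if_vanishes:
  fixes b :: "'n::finite \<Rightarrow> 'k::field"
  assumes two: "(2::'k) \<noteq> 0" and van: "\<And>v. mpoly_eval (\<lambda>c. c) v (quadratic_mpoly c b A) = 0"
  shows "quadratic_mpoly c b A = 0"
proof -
  define L where "L v = (\<Sum>j\<in>UNIV. b j * v j)" for v
  define Q where "Q v = (\<Sum>j\<in>UNIV. \<Sum>k\<in>UNIV. A j k * (v j * v k))" for v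
  have val: "c + L v + Q v = 0" for v
    using van[of v] by (simp add: mpoly_eval_quadratic_mpoly[OF id_hom.coefficient_hom_axioms] L_def Q_def)
  have c: "c = 0" using val[of "\<lambda>_. 0"] by (simp add: L_def Q_def)
  have "L (\<lambda>j. - v j) = - L v" "Q (\<lambda>j. - v j) = Q v" for v
    by (simp_all add: L_def Q_def sum_negf)
  then have "2 * L v = 0" for v using val[of v] val[of "\<lambda>j. - v j"] c by simp
  then have L: "L v = 0" for v using two by simp
  then have Q: "Q v = 0" for v using val[of v] c by simp
  let ?d = "\<lambda>j k. if k = j then 1 else 0 :: 'k"
  have d: "(\<Sum>k\<in>UNIV. f k * ?d j k) = f j" "(\<Sum>k\<in>UNIV. ?d j k * f k) = f j" for f :: "'n \<Rightarrow> 'k" and j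
  proof -
    have "(\<Sum>k\<in>UNIV. f k * ?d j k) = (\<Sum>k\<in>UNIV. if k = j then f k else 0)"
      by (rule sum.cong) auto
    then show "(\<Sum>k\<in>UNIV. f k * ?d j k) = f j" by simp
    then show "(\<Sum>k\<in>UNIV. ?d j k * f k) = f j" by (simp only: mult.commute)
  qed
  have b: "b j = 0" for j
    using L[of "?d j"] by (simp add: L_def d)
  have Qd: "(\<Sum>j\<in>UNIV. \<Sum>k\<in>UNIV. A j k * (?d j' j * ?d k' k)) = A j' k'" for j' k'
  proof -
    have "(\<Sum>j\<in>UNIV. \<Sum>k\<in>UNIV. A j k * (?d j' j * ?d k' k))
        = (\<Sum>j\<in>UNIV. ?d j' j * (\<Sum>k\<in>UNIV. A j k * ?d k' k))"
      by (simp only: sum_distrib_left mult_ac)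
    then show ?thesis by (simp only: d)
  qed
  have A: "A j k + A k j = 0" for j k
  proof -
    have "Q (\<lambda>i. ?d j i + ?d k i) = Q (?d j) + Q (?d k) + (A j k + A k j)"
      unfolding Qd[symmetric, of j k] Qd[symmetric, of k j] Q_def
      by (simp only: sum.distrib[symmetric]) (intro sum.cong refl, simp only: algebra_simps)
    then show ?thesis by (simp add: Q)
  qed
  \<comment> \<open>Vanishing values only yield \<open>A j k + A k j = 0\<close>, since the
    coefficients are not unique. The sum is therefore added to its own transpose, and the factor 2
    is cancelled.\<close>
  let ?S = "\<Sum>j\<in>UNIV. \<Sum>k\<in>UNIV. mconst (A j k) * (mvar j * mvar k) :: ('n, 'k) mpoly"
  have "?S + ?S = ?S + (\<Sum>j\<in>UNIV. \<Sum>k\<in>UNIV. mconst (A k j) * (mvar j * mvar k))"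
    by (subst (4) sum.swap) (simp add: mult_ac)
  also have "\<dots> = 0"
    by (simp add: sum.distrib[symmetric] distrib_right[symmetric] mconst_add[symmetric] A)
  finally have SS: "?S + ?S = 0" .
  have "(mconst 2 :: ('n, 'k) mpoly) = 1 + 1"
    by (metis mconst_1 mconst_add one_add_one)
  then have "mconst 2 * ?S = 0" using SS by (simp only: distrib_right mult_1_left)
  then have "mconst (1/2) * (mconst 2 * ?S) = 0" by simp
  then have "?S = 0"
    using two by (simp only: mult.assoc[symmetric] mconst_mult[symmetric]) simp
  with b c show ?thesis by (simp add: quadratic_mpoly_def affine_mpoly_def)
qed

section \<open>Formal partial derivatives of quadratic polynomials\<close>

lemma partial_deriv_superset:
  assumes "finite A" "Poly_Mapping.keys p \<subseteq> A"
  shows "partial_deriv j p = (\<Sum>e\<in>A. Poly_Mapping.single (e - Poly_Mapping.single j 1)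
    (of_nat (Poly_Mapping.lookup e j) * Poly_Mapping.lookup p e))"
  unfolding partial_deriv_def using assms
  by (intro sum.mono_neutral_left) (auto simp: in_keys_iff)

lemma partial_deriv_add: "partial_deriv j (p + q) = partial_deriv j p + partial_deriv j q"
proof -
  let ?A = "Poly_Mapping.keys p \<union> Poly_Mapping.keys q"
  have "Poly_Mapping.keys (p + q) \<subseteq> ?A" by (rule keys_add)
  then show ?thesis
    by (simp add: partial_deriv_superset[of ?A] lookup_add distrib_left single_add sum.distrib)
qed

lemma partial_deriv_0 [simp]: "partial_deriv j 0 = 0"
  by (simp add: partial_deriv_def)

lemma partial_deriv_sum: "partial_deriv j (sum f A) = (\<Sum>i\<in>A. partial_deriv j (f i))"
  by (induction A rule: infinite_finite_induct) (simp_all add: partial_deriv_add)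

lemma partial_deriv_single:
  "partial_deriv j (Poly_Mapping.single e c)
    = Poly_Mapping.single (e - Poly_Mapping.single j 1) (of_nat (Poly_Mapping.lookup e j) * c)"
  by (subst partial_deriv_superset[of "{e}"]) simp_all

lemma partial_deriv_mconst [simp]: "partial_deriv j (mconst c) = 0"
  by (simp add: mconst_def partial_deriv_single)

lemma partial_deriv_linear:
  "partial_deriv j (mconst c * mvar k) = mconst (if k = j then c else 0)" for c :: "'k::comm_ring_1"
  by (simp add: mconst_def mvar_def mult_single partial_deriv_single lookup_single)

lemma partial_deriv_quadratic:
  "partial_deriv j (mconst c * (mvar k * mvar l))
    = mconst (if k = j then c else 0) * mvar l + mconst (if l = j then c else 0) * mvar k"
  for c :: "'k::comm_ring_1"
  by (auto simp: mconst_def mvar_def mult_single partial_deriv_single lookup_single lookup_add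
      add_diff_cancel_left' single_add[symmetric] distrib_right)

lemma partial_deriv_quadratic_mpoly:
  fixes b :: "'n::finite \<Rightarrow> 'k::comm_ring_1"
  shows "partial_deriv j (quadratic_mpoly c b A) = affine_mpoly (b j) (\<lambda>k. A j k + A k j)"
proof -
  have 1: "(\<Sum>k\<in>UNIV. mconst (if k = j then f k else 0)) = mconst (f j)" for f :: "'n \<Rightarrow> 'k"
    by (simp flip: mconst_sum)
  have 2: "(\<Sum>k\<in>UNIV. \<Sum>l\<in>UNIV. mconst (if k = j then A k l else 0) * mvar l)
      = (\<Sum>l\<in>UNIV. mconst (A j l) * mvar l)"
    by (subst sum.swap) (simp add: sum_distrib_right[symmetric] 1)
  have 3: "(\<Sum>k\<in>UNIV. \<Sum>l\<in>UNIV. mconst (if l = j then A k l else 0) * mvar k)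
      = (\<Sum>k\<in>UNIV. mconst (A k j) * mvar k)"
    by (simp add: sum_distrib_right[symmetric] 1)
  show ?thesis
    by (simp add: quadratic_mpoly_def affine_mpoly_def partial_deriv_add partial_deriv_sum
        partial_deriv_linear partial_deriv_quadratic 1 2 3 sum.distrib mconst_add distrib_right)
qed

section \<open>Transcendence degree\<close>

lemma trdeg_mono: "L \<subseteq> L' \<Longrightarrow> trdeg \<iota> L \<le> trdeg \<iota> L'"
  unfolding trdeg_def by (rule Sup_subset_mono) auto

lemma card_le_trdeg:
  "finite S \<Longrightarrow> S \<subseteq> L \<Longrightarrow> algebraically_independent \<iota> S \<Longrightarrow> enat (card S) \<le> trdeg \<iota> L"
  unfolding trdeg_def by (rule Sup_upper) blast

lemma intermediate_field_generated: "intermediate_field \<iota> (generated_field \<iota> S)"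
  unfolding generated_field_def by (rule hull_in) (auto simp: intermediate_field_def image_subset_iff)

lemma mpoly_subalgebra_generated: "mpoly_subalgebra (generated_subalgebra S)"
  unfolding generated_subalgebra_def by (rule hull_in) (auto simp: mpoly_subalgebra_def image_subset_iff)

lemma constants_in_subalgebra: "mpoly_subalgebra S \<Longrightarrow> mconst d \<in> S"
  by (auto simp: mpoly_subalgebra_def)

lemma subalgebra_add: "mpoly_subalgebra S \<Longrightarrow> p \<in> S \<Longrightarrow> q \<in> S \<Longrightarrow> p + q \<in> S"
  and subalgebra_mult: "mpoly_subalgebra S \<Longrightarrow> p \<in> S \<Longrightarrow> q \<in> S \<Longrightarrow> p * q \<in> S"
  by (auto simp: mpoly_subalgebra_def)

lemma subalgebra_diff:
  assumes "mpoly_subalgebra S" "p \<in> S" "q \<in> S"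
  shows "p - q \<in> S"
proof -
  have "p + mconst (- 1) * q \<in> S"
    using assms by (intro subalgebra_add subalgebra_mult constants_in_subalgebra)
  then show ?thesis by (simp add: mconst_uminus)
qed

lemmas subalgebra_intros = constants_in_subalgebra subalgebra_add subalgebra_mult subalgebra_diff


text \<open>The cutoff outside \<open>S\<close> ensures finite support and discards the value
  \<open>undefined\<close> that extensional functions take there.\<close>

definition exponent_vector :: "'v set \<Rightarrow> ('v \<Rightarrow> nat) \<Rightarrow> 'v \<Rightarrow>\<^sub>0 nat"
  where "exponent_vector S e = Abs_poly_mapping (\<lambda>v. if v \<in> S then e v else 0)"

lemma lookup_exponent_vector:
  assumes "finite S"
  shows "Poly_Mapping.lookup (exponent_vector S e) = (\<lambda>v. if v \<in> S then e v else 0)"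
proof -
  have "finite {v. (if v \<in> S then e v else 0) \<noteq> 0}"
    by (rule finite_subset[OF _ assms]) auto
  then show ?thesis by (simp add: exponent_vector_def)
qed

lemma keys_exponent_vector: "finite S \<Longrightarrow> Poly_Mapping.keys (exponent_vector S e) \<subseteq> S"
  by (auto simp: in_keys_iff lookup_exponent_vector split: if_splits)

lemma inj_on_exponent_vector:
  assumes "finite S"
  shows "inj_on (exponent_vector S) (S \<rightarrow>\<^sub>E A)"
proof (rule inj_onI)
  fix e e' assume *: "e \<in> S \<rightarrow>\<^sub>E A" "e' \<in> S \<rightarrow>\<^sub>E A" "exponent_vector S e = exponent_vector S e'"
  then have "e v = e' v" if "v \<in> S" for v
    using lookup_exponent_vector[OF assms, of e] lookup_exponent_vector[OF assms, of e'] that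
    by (metis (full_types))
  with * show "e = e'" by (meson PiE_ext)
qed

section \<open>Upper bound for the transcendence degree: counting monomials\<close>

locale field_hom = coefficient_hom \<iota> for \<iota> :: "'k::field \<Rightarrow> 'l::field"
begin

sublocale vs: vector_space "\<lambda>c x. \<iota> c * x"
  by unfold_locales (simp_all add: distrib_left distrib_right hom_add hom_mult hom_1 mult.assoc)

text \<open>Each exponent is bounded separately, so the count is a plain power. The generators form
  an indexed family and may coincide.\<close>

definition monomials :: "('i \<Rightarrow> 'l) \<Rightarrow> 'i set \<Rightarrow> nat \<Rightarrow> 'l set"
  where "monomials \<phi> I D = (\<lambda>e. \<Prod>i\<in>I. \<phi> i ^ e i) ` {e. \<forall>i\<in>I. e i \<le> D}"

definition bounded_span :: "('i \<Rightarrow> 'l) \<Rightarrow> 'i set \<Rightarrow> nat \<Rightarrow> 'l set"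
  where "bounded_span \<phi> I D = vs.span (monomials \<phi> I D)"

lemma card_monomials:
  assumes "finite I"
  shows "finite (monomials \<phi> I D)" "card (monomials \<phi> I D) \<le> Suc D ^ card I"
proof -
  have *: "monomials \<phi> I D \<subseteq> (\<lambda>e. \<Prod>i\<in>I. \<phi> i ^ e i) ` (I \<rightarrow>\<^sub>E {..D})"
  proof
    fix x assume "x \<in> monomials \<phi> I D"
    then obtain e where e: "\<forall>i\<in>I. e i \<le> D" "x = (\<Prod>i\<in>I. \<phi> i ^ e i)"
      by (auto simp: monomials_def)
    then have "x = (\<Prod>i\<in>I. \<phi> i ^ restrict e I i)" "restrict e I \<in> I \<rightarrow>\<^sub>E {..D}" by auto
    then show "x \<in> (\<lambda>e. \<Prod>i\<in>I. \<phi> i ^ e i) ` (I \<rightarrow>\<^sub>E {..D})" by blast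
  qed
  have fin: "finite (I \<rightarrow>\<^sub>E {..D})" by (simp add: assms finite_PiE)
  then show "finite (monomials \<phi> I D)" using * by (meson finite_imageI finite_subset)
  have "card (monomials \<phi> I D) \<le> card (I \<rightarrow>\<^sub>E {..D})"
    using * fin by (meson card_image_le card_mono finite_imageI le_trans)
  then show "card (monomials \<phi> I D) \<le> Suc D ^ card I"
    using assms by (simp add: card_PiE)
qed

lemma bounded_span_mono: "D \<le> D' \<Longrightarrow> bounded_span \<phi> I D \<subseteq> bounded_span \<phi> I D'"
  unfolding bounded_span_def monomials_def
  by (rule vs.span_mono, rule image_mono) (auto intro: order_trans)

text \<open>Exponents add on monomials; the general case follows by linear extension in one factor
  at a time.\<close>

lemma bounded_span_mult:
  assumes "x \<in> bounded_span \<phi> I D" "y \<in> bounded_span \<phi> I D'"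
  shows "x * y \<in> bounded_span \<phi> I (D + D')"
proof -
  have 1: "x * y \<in> bounded_span \<phi> I (D + D')"
    if x: "x \<in> monomials \<phi> I D" and y: "y \<in> monomials \<phi> I D'" for x y
  proof -
    from x y obtain e e' where "\<forall>i\<in>I. e i \<le> D" "\<forall>i\<in>I. e' i \<le> D'"
      and xy: "x = (\<Prod>i\<in>I. \<phi> i ^ e i)" "y = (\<Prod>i\<in>I. \<phi> i ^ e' i)"
      by (auto simp: monomials_def)
    then have "(\<lambda>i. e i + e' i) \<in> {e. \<forall>i\<in>I. e i \<le> D + D'}" by (auto intro: add_mono)
    moreover have "x * y = (\<Prod>i\<in>I. \<phi> i ^ (e i + e' i))"
      by (simp add: xy power_add prod.distrib)
    ultimately have "x * y \<in> monomials \<phi> I (D + D')"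
      unfolding monomials_def by (intro image_eqI[where x = "\<lambda>i. e i + e' i"])
    then show ?thesis unfolding bounded_span_def by (rule vs.span_base)
  qed
  have sub: "vs.subspace {y. x * y \<in> bounded_span \<phi> I (D + D')}" for x
    unfolding bounded_span_def
    by (rule vs.subspaceI)
      (auto simp: distrib_left vs.span_zero mult.left_commute[of x] intro: vs.span_add vs.span_scale)
  have 2: "x * y \<in> bounded_span \<phi> I (D + D')"
    if x: "x \<in> monomials \<phi> I D" and y: "y \<in> bounded_span \<phi> I D'" for x y
    using vs.span_minimal[OF _ sub, of "monomials \<phi> I D'" x] 1[OF x] y
    unfolding bounded_span_def by blast
  have sub': "vs.subspace {x. x * y \<in> bounded_span \<phi> I (D + D')}"
    using sub[of y] by (simp add: mult.commute)
  then show ?thesis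
    using vs.span_minimal[OF _ sub', of "monomials \<phi> I D"] 2[OF _ assms(2)] assms(1)
    unfolding bounded_span_def by blast
qed

lemma bounded_span_hom: "\<iota> c \<in> bounded_span \<phi> I D"
proof -
  have "1 \<in> monomials \<phi> I D"
    unfolding monomials_def by (rule rev_image_eqI[of "\<lambda>_. 0"]) auto
  then show ?thesis
    unfolding bounded_span_def using vs.span_scale[OF vs.span_base, of 1 _ c] by simp
qed

lemma bounded_span_1: "1 \<in> bounded_span \<phi> I D"
  using bounded_span_hom[of 1] by (simp add: hom_1)

lemma bounded_span_generator:
  assumes "finite I" "i \<in> I"
  shows "\<phi> i \<in> bounded_span \<phi> I 1"
proof -
  have "(\<Prod>j\<in>I. \<phi> j ^ (if j = i then 1 else 0)) = (\<Prod>j\<in>I. if j = i then \<phi> j else 1)"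
    by (rule prod.cong) auto
  then have "\<phi> i = (\<Prod>j\<in>I. \<phi> j ^ (if j = i then 1 else 0))" using assms by simp
  then have "\<phi> i \<in> monomials \<phi> I 1"
    unfolding monomials_def by (intro rev_image_eqI[of "\<lambda>j. if j = i then 1 else 0"]) auto
  then show ?thesis unfolding bounded_span_def by (rule vs.span_base)
qed

lemma bounded_span_power: "x \<in> bounded_span \<phi> I D \<Longrightarrow> x ^ n \<in> bounded_span \<phi> I (D * n)"
proof (induction n)
  case (Suc n)
  then show ?case using bounded_span_mult[of x \<phi> I D "x ^ n" "D * n"] by simp
qed (simp add: bounded_span_1)

lemma bounded_span_prod:
  assumes "\<And>s. s \<in> S \<Longrightarrow> x s \<in> bounded_span \<phi> I (D s)"
  shows "prod x S \<in> bounded_span \<phi> I (sum D S)"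
  using assms
  by (induction S rule: infinite_finite_induct) (auto intro: bounded_span_1 bounded_span_mult)

text \<open>Fractions of polynomials in the generators, with one bound \<open>D\<close> for
  numerator and denominator. Closure under the field operations makes this set contain the generated
  field.\<close>

definition bounded_quotients :: "('i \<Rightarrow> 'l) \<Rightarrow> 'i set \<Rightarrow> 'l set"
  where "bounded_quotients \<phi> I = {x. \<exists>D. \<exists>P\<in>bounded_span \<phi> I D. \<exists>Q\<in>bounded_span \<phi> I D. Q \<noteq> 0 \<and> x = P / Q}"

lemma bounded_quotientsI:
  assumes "P \<in> bounded_span \<phi> I D" "Q \<in> bounded_span \<phi> I D'" "Q \<noteq> 0" "x = P / Q"
  shows "x \<in> bounded_quotients \<phi> I"
proof -
  have "P \<in> bounded_span \<phi> I (max D D')" "Q \<in> bounded_span \<phi> I (max D D')"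
    using assms(1,2) bounded_span_mono[of D "max D D'" \<phi> I] bounded_span_mono[of D' "max D D'" \<phi> I]
    by auto
  then show ?thesis using assms(3,4) unfolding bounded_quotients_def by blast
qed

lemma generated_field_subset_bounded_quotients:
  assumes "finite I"
  shows "generated_field \<iota> (\<phi> ` I) \<subseteq> bounded_quotients \<phi> I"
  unfolding generated_field_def
proof (rule hull_minimal)
  show "\<phi> ` I \<subseteq> bounded_quotients \<phi> I"
    using bounded_span_generator[OF assms] bounded_span_1 by (auto intro!: bounded_quotientsI[where Q = 1])
  show "intermediate_field \<iota> (bounded_quotients \<phi> I)"
    unfolding intermediate_field_def
  proof (intro conjI ballI subsetI)
    fix x assume "x \<in> range \<iota>"
    then show "x \<in> bounded_quotients \<phi> I"
      using bounded_span_hom bounded_span_1 by (auto intro!: bounded_quotientsI[where Q = 1])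
  next
    fix a b assume "a \<in> bounded_quotients \<phi> I" "b \<in> bounded_quotients \<phi> I"
    then obtain D P Q D' P' Q' where
      a: "P \<in> bounded_span \<phi> I D" "Q \<in> bounded_span \<phi> I D" "Q \<noteq> 0" "a = P / Q" and
      b: "P' \<in> bounded_span \<phi> I D'" "Q' \<in> bounded_span \<phi> I D'" "Q' \<noteq> 0" "b = P' / Q'"
      unfolding bounded_quotients_def by blast
    have PQ: "P * Q' \<in> bounded_span \<phi> I (D + D')" "P' * Q \<in> bounded_span \<phi> I (D + D')"
      "P * P' \<in> bounded_span \<phi> I (D + D')" "Q * Q' \<in> bounded_span \<phi> I (D + D')"
      using a b bounded_span_mult[of P' \<phi> I D' Q D] by (auto simp: bounded_span_mult add.commute[of D'])
    show "a * b \<in> bounded_quotients \<phi> I"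
      by (rule bounded_quotientsI[OF PQ(3,4)]) (use a b in auto)
    have "P * Q' + P' * Q \<in> bounded_span \<phi> I (D + D')"
      using PQ(1,2) unfolding bounded_span_def by (rule vs.span_add)
    then show "a + b \<in> bounded_quotients \<phi> I"
      by (rule bounded_quotientsI[OF _ PQ(4)]) (use a b in \<open>auto simp: add_frac_eq\<close>)
  next
    fix a assume "a \<in> bounded_quotients \<phi> I"
    then obtain D P Q where
      a: "P \<in> bounded_span \<phi> I D" "Q \<in> bounded_span \<phi> I D" "Q \<noteq> 0" "a = P / Q"
      unfolding bounded_quotients_def by blast
    have "- P \<in> bounded_span \<phi> I D" using a(1) unfolding bounded_span_def by (rule vs.span_neg)
    then show "- a \<in> bounded_quotients \<phi> I"
      by (rule bounded_quotientsI[OF _ a(2,3)]) (use a in auto)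
    show "inverse a \<in> bounded_quotients \<phi> I"
    proof (cases "P = 0")
      case True
      \<comment> \<open>As \<open>inverse 0 = 0\<close>, the zero element cannot be inverted by
        exchanging numerator and denominator.\<close>
      then have "inverse a = \<iota> 0 / 1" using a by (simp add: hom_0)
      then show ?thesis by (rule bounded_quotientsI[OF bounded_span_hom bounded_span_1, rotated]) simp
    next
      case False
      then show ?thesis by (rule bounded_quotientsI[OF a(2,1)]) (use a in simp)
    qed
  qed
qed

lemma common_denominator:
  assumes "finite S" "S \<subseteq> bounded_quotients \<phi> I"
  shows "\<exists>D. \<exists>Q\<in>bounded_span \<phi> I D. Q \<noteq> 0 \<and> (\<forall>s\<in>S. s * Q \<in> bounded_span \<phi> I D)"
  using assms
proof (induction S)
  case empty
  show ?case using bounded_span_1 by (intro exI bexI[of _ 1]) auto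
next
  case (insert s S)
  then obtain D Q where Q: "Q \<in> bounded_span \<phi> I D" "Q \<noteq> 0" "\<forall>s\<in>S. s * Q \<in> bounded_span \<phi> I D"
    by auto
  from insert.prems obtain D' P Q' where
    s: "P \<in> bounded_span \<phi> I D'" "Q' \<in> bounded_span \<phi> I D'" "Q' \<noteq> 0" "s = P / Q'"
    unfolding bounded_quotients_def by blast
  have "t * (Q * Q') \<in> bounded_span \<phi> I (D + D')" if "t \<in> S" for t
    using bounded_span_mult[of "t * Q" \<phi> I D Q' D'] Q s that by (simp add: mult.assoc)
  moreover have "s * (Q * Q') \<in> bounded_span \<phi> I (D + D')"
    using bounded_span_mult[of Q \<phi> I D P D'] Q s by (simp add: mult.commute)
  moreover have "Q * Q' \<in> bounded_span \<phi> I (D + D')" "Q * Q' \<noteq> 0"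
    using bounded_span_mult Q s by auto
  ultimately show ?case by blast
qed

text \<open>Clearing denominators sends the \<open>N ^ card S\<close> monomials in \<open>S\<close> with exponents below \<open>N\<close> into a
  span of \<open>O(N ^ card I)\<close> elements.\<close>

lemma algebraically_independent_card_le:
  assumes I: "finite I" and S: "finite S" "S \<subseteq> generated_field \<iota> (\<phi> ` I)"
    and indep: "algebraically_independent \<iota> S"
  shows "card S \<le> card I"
proof (rule ccontr)
  assume "\<not> card S \<le> card I"
  then have less: "card I < card S" by simp
  have "S \<subseteq> bounded_quotients \<phi> I"
    using S(2) generated_field_subset_bounded_quotients[OF I] by (rule order_trans)
  from common_denominator[OF S(1) this] obtain D Q
    where Q: "Q \<in> bounded_span \<phi> I D" "Q \<noteq> 0" "\<forall>s\<in>S. s * Q \<in> bounded_span \<phi> I D"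
    by (elim exE bexE conjE) (rule that)
  define m r where "m = card S" and "r = card I"
  \<comment> \<open>Chosen to exceed \<open>(D * m + 1) ^ r\<close>. The target span has at most
    \<open>((D * m + 1) * N) ^ r\<close> generators, which is then less than
    \<open>N ^ (r + 1)\<close> and so less than \<open>N ^ m\<close>, the number of
    monomials.\<close>
  define N where "N = Suc ((D * m + 1) ^ r)"
  define E where "E = S \<rightarrow>\<^sub>E {..<N}"
  define mon where "mon e = (\<Prod>s\<in>S. s ^ e s)" for e
  have finE: "finite E" and cardE: "card E = N ^ m"
    using S(1) by (simp_all add: E_def finite_PiE card_PiE m_def)
  have span: "mon e * Q ^ (m * N) \<in> bounded_span \<phi> I (D * m * N)" if e: "e \<in> E" for e
  proof -
    define k where "k = sum e S"
    have "k \<le> (\<Sum>s\<in>S. N)" unfolding k_def using e by (intro sum_mono) (auto simp: E_def PiE_iff less_imp_le)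
    then have k: "k \<le> m * N" by (simp add: m_def)
    have "(\<Prod>s\<in>S. (s * Q) ^ e s) = mon e * Q ^ k"
      by (simp add: power_mult_distrib prod.distrib mon_def k_def power_sum)
    \<comment> \<open>Padding with further powers of \<open>Q\<close> gives all monomials the same
      denominator, so that they lie in one common span and a relation among them survives division
      by it.\<close>
    then have "mon e * Q ^ (m * N) = (\<Prod>s\<in>S. (s * Q) ^ e s) * Q ^ (m * N - k)"
      using k by (simp add: mult.assoc power_add[symmetric])
    also have "\<dots> \<in> bounded_span \<phi> I ((\<Sum>s\<in>S. D * e s) + D * (m * N - k))"
      using Q by (intro bounded_span_mult bounded_span_prod bounded_span_power) auto
    also have "(\<Sum>s\<in>S. D * e s) + D * (m * N - k) = D * m * N"
      using k by (simp add: sum_distrib_left[symmetric] k_def[symmetric] distrib_left[symmetric] mult.assoc)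
    finally show ?thesis .
  qed
  have "card (monomials \<phi> I (D * m * N)) \<le> Suc (D * m * N) ^ r"
    using card_monomials(2)[OF I] by (simp add: r_def)
  also have "\<dots> \<le> ((D * m + 1) * N) ^ r"
    by (rule power_mono) (simp_all add: N_def)
  also have "\<dots> < N ^ Suc r"
    unfolding power_mult_distrib power_Suc
    by (rule mult_strict_right_mono) (simp_all add: N_def)
  also have "\<dots> \<le> N ^ m"
    using less by (intro power_increasing) (simp_all add: m_def r_def N_def)
  finally have few: "card (monomials \<phi> I (D * m * N)) < card E" by (simp add: cardE)
  have "(\<lambda>e. mon e * Q ^ (m * N)) ` E \<subseteq> vs.span (monomials \<phi> I (D * m * N))"
    using span unfolding bounded_span_def by (rule image_subsetI)
  then obtain c e0 where c: "e0 \<in> E" "c e0 \<noteq> 0" "(\<Sum>e\<in>E. \<iota> (c e) * (mon e * Q ^ (m * N))) = 0"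
    by (rule vs.family_dependent[OF finE card_monomials(1)[OF I] _ few])
  have "(\<Sum>e\<in>E. \<iota> (c e) * mon e) * Q ^ (m * N) = 0"
    using c(3) by (simp add: sum_distrib_right mult.assoc)
  then have zero: "(\<Sum>e\<in>E. \<iota> (c e) * mon e) = 0" using Q(2) by simp
  define p where "p = (\<Sum>e\<in>E. Poly_Mapping.single (exponent_vector S e) (c e))"
  have "meval_monom (\<lambda>v. v) (exponent_vector S e) = mon e" for e
    by (simp add: meval_monom_superset[OF S(1) keys_exponent_vector[OF S(1)]] mon_def
        lookup_exponent_vector[OF S(1)])
  then have "mpoly_eval \<iota> (\<lambda>v. v) p = 0"
    by (simp add: p_def mpoly_eval_sum mpoly_eval_single zero)
  moreover have "mpoly_vars p \<subseteq> S"
  proof -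
    have "Poly_Mapping.keys p \<subseteq> (\<Union>e\<in>E. Poly_Mapping.keys (Poly_Mapping.single (exponent_vector S e) (c e)))"
      unfolding p_def by (rule keys_sum)
    also have "\<dots> \<subseteq> exponent_vector S ` E" by (auto split: if_splits)
    finally show ?thesis using keys_exponent_vector[OF S(1)] by (fastforce simp: mpoly_vars_def)
  qed
  moreover have "Poly_Mapping.lookup p (exponent_vector S e0) = c e0"
  proof -
    have "Poly_Mapping.lookup p (exponent_vector S e0) = (\<Sum>e\<in>E. if e = e0 then c e else 0)"
      unfolding p_def lookup_sum
      using inj_on_exponent_vector[OF S(1), of "{..<N}"] c(1)
      by (intro sum.cong) (auto simp: lookup_single when_def inj_on_def E_def)
    then show ?thesis using finE c(1) by simp
  qed
  ultimately show False
    using indep c(2) unfolding algebraically_independent_def by fastforce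
qed

lemma trdeg_generated_field_le:
  assumes "finite I"
  shows "trdeg \<iota> (generated_field \<iota> (\<phi> ` I)) \<le> enat (card I)"
  unfolding trdeg_def
proof (rule Sup_least)
  fix d
  assume "d \<in> {enat (card S) |S.
    finite S \<and> S \<subseteq> generated_field \<iota> (\<phi> ` I) \<and> algebraically_independent \<iota> S}"
  then obtain S where S: "d = enat (card S)" "finite S" "S \<subseteq> generated_field \<iota> (\<phi> ` I)"
    "algebraically_independent \<iota> S"
    by (elim CollectE exE conjE)
  then show "d \<le> enat (card I)"
    using algebraically_independent_card_le[OF assms S(2-4)] by simp
qed

end

interpretation ratconst_hom: field_hom "ratconst :: 'k::field \<Rightarrow> ('n::linorder, 'k) mratfun"
  by unfold_locales

text \<open>If a substitution turns the elements of \<open>Q\<close> into univariate polynomials of orders \<open>w q\<close>, and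
  the weighted degrees of the relevant monomials are distinct, then the monomial of least weight
  cannot be cancelled.\<close>

lemma algebraically_independent_by_order:
  fixes Q :: "('n::linorder, 'k::field) mpoly set"
  assumes fin: "finite Q"
    and order: "\<And>N. \<exists>a w. (\<forall>q\<in>Q. \<exists>u. mpoly_eval (\<lambda>c. [:c:]) a q = monom 1 (w q) * u \<and> coeff u 0 = 1)
      \<and> (\<forall>f f'. (\<forall>q\<in>Q. f q < N \<and> f' q < N) \<longrightarrow> (\<Sum>q\<in>Q. f q * w q) = (\<Sum>q\<in>Q. f' q * w q)
           \<longrightarrow> (\<forall>q\<in>Q. f q = f' q))"
  shows "algebraically_independent (ratconst :: 'k \<Rightarrow> ('n, 'k) mratfun) (to_mratfun ` Q)"
  unfolding algebraically_independent_def
proof (intro allI impI)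
  fix P :: "(('n, 'k) mratfun, 'k) mpoly"
  assume vars: "mpoly_vars P \<subseteq> to_mratfun ` Q" and zero: "mpoly_eval ratconst (\<lambda>v. v) P = 0"
  let ?K = "Poly_Mapping.keys P"
  let ?l = "\<lambda>e q. Poly_Mapping.lookup e (to_mratfun q)"
  have inj: "inj_on to_mratfun Q" by (auto simp: inj_on_def)
  have keys: "Poly_Mapping.keys e \<subseteq> to_mratfun ` Q" if "e \<in> ?K" for e
    using vars that by (auto simp: mpoly_vars_def)
  \<comment> \<open>The successor of the sum of all exponents in \<open>P\<close> is a strict bound
    for each of them.\<close>
  define N where "N = Suc (\<Sum>e\<in>?K. \<Sum>v\<in>to_mratfun ` Q. Poly_Mapping.lookup e v)"
  have N: "?l e q < N" if "e \<in> ?K" "q \<in> Q" for e q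
  proof -
    have "?l e q \<le> (\<Sum>v\<in>to_mratfun ` Q. Poly_Mapping.lookup e v)"
      using fin that by (intro member_le_sum) auto
    also have "\<dots> \<le> (\<Sum>e\<in>?K. \<Sum>v\<in>to_mratfun ` Q. Poly_Mapping.lookup e v)"
      using that by (intro member_le_sum) auto
    finally show ?thesis by (simp add: N_def)
  qed
  from order[of N] obtain a w where
    ord: "\<forall>q\<in>Q. \<exists>u. mpoly_eval (\<lambda>c. [:c:]) a q = monom 1 (w q) * u \<and> coeff u 0 = 1" and
    dist: "\<forall>f f'. (\<forall>q\<in>Q. f q < N \<and> f' q < N) \<longrightarrow> (\<Sum>q\<in>Q. f q * w q) = (\<Sum>q\<in>Q. f' q * w q)
      \<longrightarrow> (\<forall>q\<in>Q. f q = f' q)"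
    by (elim exE conjE) (rule that)
  from bchoice[OF ord] obtain u where
    u: "\<And>q. q \<in> Q \<Longrightarrow> mpoly_eval (\<lambda>c. [:c:]) a q = monom 1 (w q) * u q \<and> coeff (u q) 0 = 1"
    by blast
  define W where "W e = (\<Sum>q\<in>Q. ?l e q * w q)" for e
  define U where "U e = (\<Prod>q\<in>Q. u q ^ ?l e q)" for e
  have U: "coeff (U e) 0 = 1" for e
  proof -
    have "coeff (prod f Q) 0 = (\<Prod>q\<in>Q. coeff (f q) 0)" for f :: "_ \<Rightarrow> 'k poly"
      by (induction Q rule: infinite_finite_induct) (simp_all add: coeff_mult_0)
    then show ?thesis using u by (simp add: U_def coeff_0_power)
  qed
  have injW: "e = e'" if e: "e \<in> ?K" "e' \<in> ?K" "W e = W e'" for e e'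
  proof (rule poly_mapping_eqI)
    fix v
    have *: "\<forall>q\<in>Q. ?l e q = ?l e' q"
      using dist[rule_format, of "?l e" "?l e'"] N e by (auto simp: W_def)
    show "Poly_Mapping.lookup e v = Poly_Mapping.lookup e' v"
    proof (cases "v \<in> to_mratfun ` Q")
      case False
      then have "v \<notin> Poly_Mapping.keys e" "v \<notin> Poly_Mapping.keys e'"
        using keys[OF e(1)] keys[OF e(2)] by blast+
      then show ?thesis by (simp add: in_keys_iff)
    qed (use * in auto)
  qed
  have "meval_monom (\<lambda>v. v) e = to_mratfun (\<Prod>q\<in>Q. q ^ ?l e q)" if "e \<in> ?K" for e
  proof -
    have "to_mratfun (prod f Q) = (\<Prod>q\<in>Q. to_mratfun (f q))" for f :: "_ \<Rightarrow> ('n, 'k) mpoly"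
      by (induction Q rule: infinite_finite_induct) (simp_all add: to_mratfun_mult)
    then show ?thesis
      using fin keys[OF that]
      by (subst meval_monom_superset[of "to_mratfun ` Q"]) (simp_all add: prod.reindex[OF inj] to_mratfun_power)
  qed
  then have "mpoly_eval ratconst (\<lambda>v. v) P
      = to_mratfun (\<Sum>e\<in>?K. mconst (Poly_Mapping.lookup P e) * (\<Prod>q\<in>Q. q ^ ?l e q))"
    by (subst ratconst_hom.mpoly_eval_superset[of ?K])
      (simp_all add: ratconst_def to_mratfun_sum to_mratfun_mult)
  with zero have z: "(\<Sum>e\<in>?K. mconst (Poly_Mapping.lookup P e) * (\<Prod>q\<in>Q. q ^ ?l e q)) = 0"
    by simp
  have "mpoly_eval (\<lambda>c. [:c:]) a (\<Prod>q\<in>Q. q ^ ?l e q) = monom 1 (W e) * U e" for e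
  proof -
    have "mpoly_eval (\<lambda>c. [:c:]) a (prod f Q) = (\<Prod>q\<in>Q. mpoly_eval (\<lambda>c. [:c:]) a (f q))" for f
      by (induction Q rule: infinite_finite_induct) (simp_all add: const_poly_hom.mpoly_eval_mult)
    moreover have "(\<Prod>q\<in>Q. monom 1 (w q) ^ ?l e q) = monom (1::'k) (W e)"
      unfolding W_def
      by (induction Q rule: infinite_finite_induct)
        (simp_all add: monom_power mult_monom mult.commute monom_eq_1)
    ultimately show ?thesis
      using u by (simp add: const_poly_hom.mpoly_eval_power power_mult_distrib prod.distrib U_def)
  qed
  then have sum0: "(\<Sum>e\<in>?K. [:Poly_Mapping.lookup P e:] * (monom 1 (W e) * U e)) = 0"
    using arg_cong[OF z, of "mpoly_eval (\<lambda>c. [:c:]) a"]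
    by (simp add: const_poly_hom.mpoly_eval_sum const_poly_hom.mpoly_eval_mult)
  have c0: "(\<Sum>e\<in>?K. Poly_Mapping.lookup P e * coeff (monom 1 (W e) * U e) k) = 0" for k
    using arg_cong[OF sum0, of "\<lambda>p. coeff p k"] by (simp add: coeff_sum)
  show "P = 0"
  proof (rule ccontr)
    assume "P \<noteq> 0"
    then have "?K \<noteq> {}" by simp
    then obtain e0 where e0: "e0 \<in> ?K" "\<And>e. e \<in> ?K \<Longrightarrow> W e0 \<le> W e"
      using ex_is_arg_min_if_finite[OF finite_keys, of P W] by (auto simp: is_arg_min_linorder)
    \<comment> \<open>Terms of larger weight start beyond degree \<open>W e0\<close>, and
      \<open>injW\<close> leaves only \<open>e0\<close> at this weight. Its factor
      \<open>U e0\<close> has constant term 1, so the coefficient of \<open>P\<close> itself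
      appears.\<close>
    have "(\<Sum>e\<in>?K. Poly_Mapping.lookup P e * coeff (monom 1 (W e) * U e) (W e0))
      = (\<Sum>e\<in>?K. if e = e0 then Poly_Mapping.lookup P e else 0)"
      using e0 injW by (intro sum.cong) (auto simp: coeff_monom_mult U le_less)
    with c0[of "W e0"] e0(1) show False by (simp add: in_keys_iff)
  qed
qed

section \<open>Gradients and Hessians of quadratic maps\<close>

lemma det2_eq_0_if_dependent:
  fixes f g :: "'t \<Rightarrow> 'a::idom"
  assumes "\<And>t. c * f t + d * g t = 0" "c \<noteq> 0 \<or> d \<noteq> 0"
  shows "det2 f g s t = 0"
proof -
  have "c * det2 f g s t = (c * f s + d * g s) * g t - (c * f t + d * g t) * g s"
    "d * det2 f g s t = (c * f t + d * g t) * f s - (c * f s + d * g s) * f t"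
    by (simp_all add: det2_def algebra_simps)
  then have "c * det2 f g s t = 0" "d * det2 f g s t = 0"
    by (simp_all only: assms(1)) simp_all
  then show ?thesis using assms(2) by auto
qed

lemma det3_eq_0_if_dependent:
  fixes f g h :: "'t \<Rightarrow> 'a::idom"
  assumes z: "\<And>t. c * f t + d * g t + e * h t = 0" and "c \<noteq> 0 \<or> d \<noteq> 0 \<or> e \<noteq> 0"
  shows "det3 f g h s t u = 0"
proof -
  let ?z = "\<lambda>t. c * f t + d * g t + e * h t"
  have "c * det3 f g h s t u = det3 ?z g h s t u" "d * det3 f g h s t u = det3 f ?z h s t u"
    "e * det3 f g h s t u = det3 f g ?z s t u"
    by (simp_all add: det2_def det3_def algebra_simps)
  then have "c * det3 f g h s t u = 0" "d * det3 f g h s t u = 0" "e * det3 f g h s t u = 0"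
    by (simp_all only: z) (simp_all add: det3_def det2_def)
  then show ?thesis using assms(2) by auto
qed

text \<open>The rank is the dimension of the row space, so any larger family inside that space is
  dependent, repeated members included.\<close>

lemma rows_dependent:
  fixes J :: "'a::field^'n^'m"
  assumes "finite I" "rank J < card I" "\<And>i. i \<in> I \<Longrightarrow> R i \<in> vec.span (rows J)"
  obtains c i where "i \<in> I" "c i \<noteq> 0" "(\<Sum>i\<in>I. c i *s R i) = 0"
proof -
  obtain T where T: "T \<subseteq> rows J" "vec.independent T" "rows J \<subseteq> vec.span T"
    "card T = vec.dim (rows J)"
    by (rule vec.basis_exists)
  have "finite T" using T(2) by (rule vec.finiteI_independent)
  moreover have "R ` I \<subseteq> vec.span T"
    using assms(3) vec.span_minimal[OF T(3) vec.subspace_span] by blast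
  moreover have "card T < card I" using assms(2) T(4) by (simp add: row_rank_def_gen)
  ultimately obtain c i where "i \<in> I" "c i \<noteq> 0" "(\<Sum>i\<in>I. c i *s R i) = 0"
    by (rule vec.family_dependent[OF assms(1)])
  then show ?thesis by (rule that)
qed

lemma rank_le_1_if_minors_vanish:
  fixes J :: "'a::field^'n^'m"
  assumes "\<And>i i' j j'. J $ i $ j * J $ i' $ j' = J $ i $ j' * J $ i' $ j"
  shows "rank J \<le> 1"
proof (cases "\<exists>i j. J $ i $ j \<noteq> 0")
  case True
  then obtain i j where ij: "J $ i $ j \<noteq> 0" by blast
  have "J $ i' = (J $ i' $ j / J $ i $ j) *s J $ i" for i'
    using ij assms[of i _ i' j] by (simp add: vec_eq_iff field_simps)
  then have "J $ i' \<in> vec.span {J $ i}" for i'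
    by (metis singletonI vec.span_base vec.span_scale)
  then have "rows J \<subseteq> vec.span {J $ i}"
    unfolding rows_def row_def by (auto simp: vec_lambda_eta)
  then show ?thesis unfolding row_rank_def_gen using vec.dim_le_card[of "rows J" "{J $ i}"] by simp
next
  case False
  then have "rows J \<subseteq> vec.span {}" by (auto simp: rows_def row_def vec_eq_iff)
  then have "vec.dim (rows J) \<le> card ({} :: ('a^'n) set)" by (rule vec.dim_le_card) simp
  then show ?thesis unfolding row_rank_def_gen by (metis card.empty le_trans zero_le_one)
qed

lemma rank_eq_0_if_zero:
  fixes J :: "'a::field^'n^'m"
  assumes "\<And>i j. J $ i $ j = 0"
  shows "rank J = 0"
proof -
  have "rows J \<subseteq> vec.span {}" using assms by (auto simp: rows_def row_def vec_eq_iff)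
  then show ?thesis using vec.dim_le_card[of "rows J" "{}"] by (simp add: row_rank_def_gen)
qed

lemma rank_0_imp_zero:
  fixes J :: "'a::field^'n^'m"
  assumes "rank J = 0"
  shows "J $ i $ j = 0"
proof -
  have "J $ i \<in> rows J" by (auto simp: rows_def row_def vec_lambda_eta)
  then have "J $ i = 0" using assms vec.dim_eq_0[of "rows J"] by (auto simp: row_rank_def_gen)
  then show ?thesis by simp
qed

section \<open>Linear and bilinear maps as polynomials\<close>

definition linear_form :: "('k^'n \<Rightarrow> 'k) \<Rightarrow> ('n::finite, 'k::comm_ring_1) mpoly"
  where "linear_form \<phi> = (\<Sum>j\<in>UNIV. mconst (\<phi> (axis j 1)) * mvar j)"

text \<open>Coefficients are read off from the bilinear map rather than from its values on the
  diagonal, so identities between maps become polynomial identities over finite fields too.\<close>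

definition bilinear_form :: "('k^'n \<Rightarrow> 'k^'n \<Rightarrow> 'k) \<Rightarrow> ('n::finite, 'k::comm_ring_1) mpoly"
  where "bilinear_form \<psi> =
    (\<Sum>j\<in>UNIV. \<Sum>k\<in>UNIV. mconst (\<psi> (axis j 1) (axis k 1)) * (mvar j * mvar k))"

lemma linear_form_add: "linear_form (\<lambda>t. \<phi> t + \<phi>' t) = linear_form \<phi> + linear_form \<phi>'"
  by (simp add: linear_form_def mconst_add distrib_right sum.distrib)

lemma linear_form_scale: "linear_form (\<lambda>t. c * \<phi> t) = mconst c * linear_form \<phi>"
  by (simp add: linear_form_def mconst_mult sum_distrib_left mult.assoc)

lemma linear_form_sum: "linear_form (\<lambda>t. \<Sum>i\<in>I. \<phi> i t) = (\<Sum>i\<in>I. linear_form (\<phi> i))"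
  unfolding linear_form_def mconst_sum sum_distrib_right by (rule sum.swap)

lemma bilinear_form_add:
  "bilinear_form (\<lambda>w t. \<psi> w t + \<psi>' w t) = bilinear_form \<psi> + bilinear_form \<psi>'"
  by (simp add: bilinear_form_def mconst_add distrib_right sum.distrib)

lemma bilinear_form_scale: "bilinear_form (\<lambda>w t. c * \<psi> w t) = mconst c * bilinear_form \<psi>"
  by (simp add: bilinear_form_def mconst_mult sum_distrib_left mult.assoc)

lemma bilinear_form_sum:
  "bilinear_form (\<lambda>w t. \<Sum>i\<in>I. \<psi> i w t) = (\<Sum>i\<in>I. bilinear_form (\<psi> i))"
  by (induction I rule: infinite_finite_induct)
    (simp_all add: bilinear_form_add, simp_all add: bilinear_form_def)

lemma bilinear_form_mult: "bilinear_form (\<lambda>w t. \<phi> w * \<phi>' t) = linear_form \<phi> * linear_form \<phi>'"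
  by (simp add: bilinear_form_def linear_form_def mconst_mult sum_product mult_ac)

lemmas form_simps = linear_form_add linear_form_scale
  bilinear_form_add bilinear_form_scale bilinear_form_mult

lemma sum_mult_axis: "(\<Sum>i\<in>UNIV. f i * axis j 1 $ i) = f j" for f :: "'i::finite \<Rightarrow> 'a::comm_ring_1"
proof -
  have "(\<Sum>i\<in>UNIV. f i * axis j 1 $ i) = (\<Sum>i\<in>UNIV. if i = j then f i else 0)"
    by (rule sum.cong) (auto simp: axis_def)
  then show ?thesis by simp
qed

lemma sum_axis_mult: "(\<Sum>i\<in>UNIV. axis j 1 $ i * f i) = f j" for f :: "'i::finite \<Rightarrow> 'a::comm_ring_1"
  using sum_mult_axis[of f j] by (simp only: mult.commute)

lemma mconst_axis: "mconst (axis i 1 $ j) = axis i 1 $ j"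
  by (simp add: axis_def)

lemma linear_form_coordinates:
  "linear_form (\<lambda>t. \<Sum>j\<in>UNIV. f j * t $ j) = (\<Sum>j\<in>UNIV. mconst (f j) * mvar j)"
  by (simp add: linear_form_def sum_mult_axis)

lemma linear_form_component: "linear_form (\<lambda>t. t $ j) = mvar j"
proof -
  have "axis k 1 $ j = (if k = j then 1 else 0 :: 'b)" for k
    by (simp add: axis_def)
  then show ?thesis by (simp add: linear_form_def sum_delta_mult)
qed

lemma bilinear_form_coordinates:
  "bilinear_form (\<lambda>w t. \<Sum>j\<in>UNIV. \<Sum>k\<in>UNIV. F j k * (w $ j * t $ k))
    = (\<Sum>j\<in>UNIV. \<Sum>k\<in>UNIV. mconst (F j k) * (mvar j * mvar k))"
proof -
  have "(\<Sum>j\<in>UNIV. \<Sum>k\<in>UNIV. F j k * (axis j' 1 $ j * axis k' 1 $ k)) = F j' k'" for j' k'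
  proof -
    have "(\<Sum>j\<in>UNIV. \<Sum>k\<in>UNIV. F j k * (axis j' 1 $ j * axis k' 1 $ k))
      = (\<Sum>j\<in>UNIV. (\<Sum>k\<in>UNIV. F j k * axis k' 1 $ k) * axis j' 1 $ j)"
      by (simp add: sum_distrib_left sum_distrib_right mult_ac)
    then show ?thesis by (simp only: sum_mult_axis)
  qed
  then show ?thesis by (simp add: bilinear_form_def)
qed

context coefficient_hom
begin

lemma hom_sum: "\<iota> (sum f A) = (\<Sum>i\<in>A. \<iota> (f i))"
  by (induction A rule: infinite_finite_induct) (simp_all add: hom_0 hom_add)

text \<open>The substituted point is the combination of the vectors \<open>p l\<close> with weights
  \<open>z l\<close>. This covers a point, a line and a curve in two directions at once.\<close>

lemma mpoly_eval_linear_form: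
  assumes "\<And>t. \<phi> t = (\<Sum>j\<in>UNIV. f j * t $ j)"
  shows "mpoly_eval \<iota> (\<lambda>j. \<Sum>l\<in>L. \<iota> (p l $ j) * z l) (linear_form \<phi>) = (\<Sum>l\<in>L. \<iota> (\<phi> (p l)) * z l)"
proof -
  have \<phi>: "\<phi> = (\<lambda>t. \<Sum>j\<in>UNIV. f j * t $ j)" using assms by blast
  have "mpoly_eval \<iota> (\<lambda>j. \<Sum>l\<in>L. \<iota> (p l $ j) * z l) (linear_form \<phi>)
      = (\<Sum>j\<in>UNIV. \<Sum>l\<in>L. \<iota> (f j) * (\<iota> (p l $ j) * z l))"
    by (simp add: \<phi> linear_form_coordinates mpoly_eval_sum mpoly_eval_mult sum_distrib_left)
  also have "\<dots> = (\<Sum>l\<in>L. \<iota> (\<phi> (p l)) * z l)"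
    by (subst sum.swap) (simp add: \<phi> hom_sum hom_mult sum_distrib_right mult.assoc)
  finally show ?thesis .
qed

lemma mpoly_eval_bilinear_form:
  assumes "\<And>w t. \<psi> w t = (\<Sum>j\<in>UNIV. \<Sum>k\<in>UNIV. F j k * (w $ j * t $ k))"
  shows "mpoly_eval \<iota> (\<lambda>j. \<Sum>l\<in>L. \<iota> (p l $ j) * z l) (bilinear_form \<psi>)
    = (\<Sum>l\<in>L. \<Sum>l'\<in>L. \<iota> (\<psi> (p l) (p l')) * (z l * z l'))"
proof -
  let ?a = "\<lambda>j. \<Sum>l\<in>L. \<iota> (p l $ j) * z l"
  have \<psi>: "\<psi> = (\<lambda>w t. \<Sum>j\<in>UNIV. \<Sum>k\<in>UNIV. F j k * (w $ j * t $ k))"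
    using assms by blast
  have \<psi>': "\<psi> = (\<lambda>w t. \<Sum>j\<in>UNIV. w $ j * (\<Sum>k\<in>UNIV. F j k * t $ k))"
    by (simp add: \<psi> sum_distrib_left mult_ac)
  have lin: "mpoly_eval \<iota> ?a (linear_form (\<lambda>t. \<Sum>k\<in>UNIV. F j k * t $ k))
      = (\<Sum>l'\<in>L. \<iota> (\<Sum>k\<in>UNIV. F j k * p l' $ k) * z l')" for j
    by (rule mpoly_eval_linear_form) (rule refl)
  have "mpoly_eval \<iota> ?a (bilinear_form \<psi>)
      = (\<Sum>j\<in>UNIV. ?a j * mpoly_eval \<iota> ?a (linear_form (\<lambda>t. \<Sum>k\<in>UNIV. F j k * t $ k)))"
    by (simp add: \<psi> bilinear_form_coordinates linear_form_coordinates mpoly_eval_sum mpoly_eval_mult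
        sum_distrib_left mult_ac)
  also have "\<dots> = (\<Sum>j\<in>UNIV. ?a j * (\<Sum>l'\<in>L. \<iota> (\<Sum>k\<in>UNIV. F j k * p l' $ k) * z l'))"
    by (simp only: lin)
  also have "\<dots> = (\<Sum>j\<in>UNIV. \<Sum>l\<in>L. \<Sum>l'\<in>L.
      \<iota> (p l $ j * (\<Sum>k\<in>UNIV. F j k * p l' $ k)) * (z l * z l'))"
    by (simp add: sum_product hom_mult mult_ac)
  also have "\<dots> = (\<Sum>l\<in>L. \<Sum>l'\<in>L. \<Sum>j\<in>UNIV.
      \<iota> (p l $ j * (\<Sum>k\<in>UNIV. F j k * p l' $ k)) * (z l * z l'))"
    by (subst sum.swap) (rule sum.cong[OF refl], rule sum.swap)
  also have "\<dots> = (\<Sum>l\<in>L. \<Sum>l'\<in>L. \<iota> (\<psi> (p l) (p l')) * (z l * z l'))"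
    by (simp add: \<psi>' hom_sum sum_distrib_right)
  finally show ?thesis .
qed

end

section \<open>Differentials and Hessians of combinations of the components\<close>

locale quadratic_data =
  fixes c :: "'m::finite \<Rightarrow> 'k::field"
    and b :: "'m \<Rightarrow> 'n::{finite,linorder} \<Rightarrow> 'k"
    and A :: "'m \<Rightarrow> 'n \<Rightarrow> 'n \<Rightarrow> 'k"
    and H :: "('n, 'k) mpoly ^ 'm"
  assumes two: "(2::'k) \<noteq> 0"
    and H: "H $ i = quadratic_mpoly (c i) (b i) (A i)"
begin

definition slope :: "'k^'m \<Rightarrow> 'k^'n::{finite,linorder} \<Rightarrow> 'k"
  where "slope y t = (\<Sum>i\<in>UNIV. y $ i * (\<Sum>j\<in>UNIV. b i j * t $ j))"

text \<open>Symmetrising \<open>A\<close> gives the true second derivative; on the diagonal it is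
  twice the quadratic part, which explains the factors 1/2 below.\<close>

definition hessian :: "'k^'m \<Rightarrow> 'k^'n::{finite,linorder} \<Rightarrow> 'k^'n::{finite,linorder} \<Rightarrow> 'k"
  where "hessian y w t =
    (\<Sum>i\<in>UNIV. y $ i * (\<Sum>j\<in>UNIV. \<Sum>k\<in>UNIV. (A i j k + A i k j) * (w $ j * t $ k)))"

definition gradient :: "'k^'n::{finite,linorder} \<Rightarrow> 'k^'m \<Rightarrow> 'k^'n::{finite,linorder} \<Rightarrow> 'k"
  where "gradient v y t = slope y t + hessian y v t"

text \<open>Kept as a polynomial: minors vanish in this ring first and are only afterwards
  restricted to lines.\<close>

definition directional_deriv :: "'k^'m \<Rightarrow> 'k^'n::{finite,linorder} \<Rightarrow> ('n, 'k) mpoly"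
  where "directional_deriv y t =
    (\<Sum>i\<in>UNIV. \<Sum>j\<in>UNIV. mconst (y $ i * t $ j) * partial_deriv j (H $ i))"

definition combination :: "'k^'m \<Rightarrow> ('n, 'k) mpoly"
  where "combination y = (\<Sum>i\<in>UNIV. mconst (y $ i) * H $ i)"

definition constant_term :: "'k^'m \<Rightarrow> 'k"
  where "constant_term y = (\<Sum>i\<in>UNIV. y $ i * c i)"

lemma slope_linear:
  "slope (y + y') t = slope y t + slope y' t" "slope (d *s y) t = d * slope y t"
  "slope y (t + t') = slope y t + slope y t'" "slope y (d *s t) = d * slope y t"
  by (simp_all add: slope_def distrib_left distrib_right sum.distrib sum_distrib_left mult_ac)

lemma hessian_linear:
  "hessian (y + y') w t = hessian y w t + hessian y' w t" "hessian (d *s y) w t = d * hessian y w t"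
  "hessian y w (t + t') = hessian y w t + hessian y w t'" "hessian y w (d *s t) = d * hessian y w t"
  by (simp_all add: hessian_def distrib_left distrib_right sum.distrib sum_distrib_left mult_ac)

lemma hessian_commute: "hessian y w t = hessian y t w"
  unfolding hessian_def
  by (rule sum.cong[OF refl], subst sum.swap) (simp add: mult_ac add_ac)

sublocale family: quadratic_family "gradient v" hessian for v
  by unfold_locales
    (simp_all add: two hessian_commute[of _ _ w for w] gradient_def slope_linear hessian_linear distrib_left)

lemma slope_coordinates: "slope y t = (\<Sum>j\<in>UNIV. (\<Sum>i\<in>UNIV. y $ i * b i j) * t $ j)"
  unfolding slope_def sum_distrib_left sum_distrib_right by (subst sum.swap) (simp add: mult_ac)

lemma hessian_coordinates:
  "hessian y w t = (\<Sum>j\<in>UNIV. \<Sum>k\<in>UNIV. (\<Sum>i\<in>UNIV. y $ i * (A i j k + A i k j)) * (w $ j * t $ k))"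
proof -
  have "hessian y w t = (\<Sum>i\<in>UNIV. \<Sum>j\<in>UNIV. \<Sum>k\<in>UNIV. y $ i * (A i j k + A i k j) * (w $ j * t $ k))"
    by (simp add: hessian_def sum_distrib_left mult.assoc)
  also have "\<dots> = (\<Sum>j\<in>UNIV. \<Sum>i\<in>UNIV. \<Sum>k\<in>UNIV. y $ i * (A i j k + A i k j) * (w $ j * t $ k))"
    by (rule sum.swap)
  also have "\<dots> = (\<Sum>j\<in>UNIV. \<Sum>k\<in>UNIV. \<Sum>i\<in>UNIV. y $ i * (A i j k + A i k j) * (w $ j * t $ k))"
    by (rule sum.cong[OF refl], rule sum.swap)
  finally show ?thesis by (simp add: sum_distrib_right)
qed

lemma hessian_coordinates_left:
  "hessian y w t = (\<Sum>j\<in>UNIV. (\<Sum>k\<in>UNIV. (\<Sum>i\<in>UNIV. y $ i * (A i j k + A i k j)) * t $ k) * w $ j)"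
  unfolding hessian_coordinates[of y w t] by (simp add: sum_distrib_left sum_distrib_right mult_ac)

lemma combination_expand:
  "combination y = mconst (constant_term y) + linear_form (slope y) + mconst (1/2) * bilinear_form (hessian y)"
proof -
  define S where "S i = (\<Sum>j\<in>UNIV. \<Sum>k\<in>UNIV. mconst (A i j k) * (mvar j * mvar k))" for i
  have "bilinear_form (\<lambda>w t. \<Sum>j\<in>UNIV. \<Sum>k\<in>UNIV. (A i j k + A i k j) * (w $ j * t $ k)) = S i + S i" for i
  proof -
    have "(\<Sum>j\<in>UNIV. \<Sum>k\<in>UNIV. mconst (A i k j) * (mvar j * mvar k)) = S i"
      unfolding S_def by (subst sum.swap) (simp add: mult_ac)
    then have "(\<Sum>j\<in>UNIV. \<Sum>k\<in>UNIV. mconst (A i j k + A i k j) * (mvar j * mvar k)) = S i + S i"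
      by (simp only: mconst_add distrib_right sum.distrib S_def)
    then show ?thesis by (simp only: bilinear_form_coordinates)
  qed
  then have "bilinear_form (hessian y) = (\<Sum>i\<in>UNIV. mconst (y $ i) * (S i + S i))"
    unfolding hessian_def by (simp add: bilinear_form_sum bilinear_form_scale)
  moreover have half: "mconst (1/2) * (x + x) = x" for x :: "('n, 'k) mpoly"
  proof -
    have "mconst (1/2) * (x + x) = mconst (1/2 + 1/2) * x"
      by (simp only: mconst_add distrib_left distrib_right)
    also have "1/2 + 1/2 = (1::'k)" using two by (simp add: field_simps)
    finally show ?thesis by simp
  qed
  ultimately have "mconst (1/2) * bilinear_form (hessian y) = (\<Sum>i\<in>UNIV. mconst (y $ i) * S i)"
    by (simp only: sum_distrib_left mult.left_commute[of "mconst (1/2)"] half)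
  moreover have "linear_form (slope y) = (\<Sum>i\<in>UNIV. mconst (y $ i) * (\<Sum>j\<in>UNIV. mconst (b i j) * mvar j))"
    unfolding slope_def by (simp add: linear_form_sum linear_form_scale linear_form_component)
  ultimately show ?thesis
    by (simp add: combination_def constant_term_def H quadratic_mpoly_def affine_mpoly_def S_def
        mconst_sum mconst_mult distrib_left sum.distrib)
qed

lemma combination_axis: "combination (axis i 1) = H $ i"
  by (simp add: combination_def mconst_axis sum_axis_mult)

lemma directional_deriv_axis: "directional_deriv (axis i 1) (axis j 1) = partial_deriv j (H $ i)"
  by (simp add: directional_deriv_def mconst_mult mconst_axis mult.assoc sum_axis_mult
      flip: sum_distrib_left)

lemma directional_deriv_expand:
  "directional_deriv y t = mconst (slope y t) + linear_form (\<lambda>w. hessian y w t)"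
proof -
  let ?l = "\<lambda>i j w. \<Sum>k\<in>UNIV. (A i j k + A i k j) * w $ k"
  have "partial_deriv j (H $ i) = mconst (b i j) + linear_form (?l i j)" for i j
    by (simp add: H partial_deriv_quadratic_mpoly affine_mpoly_def linear_form_coordinates)
  then have "directional_deriv y t = (\<Sum>i\<in>UNIV. \<Sum>j\<in>UNIV. mconst (y $ i * t $ j) * mconst (b i j))
    + (\<Sum>i\<in>UNIV. \<Sum>j\<in>UNIV. mconst (y $ i * t $ j) * linear_form (?l i j))"
    by (simp add: directional_deriv_def distrib_left sum.distrib)
  also have "(\<Sum>i\<in>UNIV. \<Sum>j\<in>UNIV. mconst (y $ i * t $ j) * mconst (b i j)) = mconst (slope y t)"
    by (simp add: slope_def mconst_sum mconst_mult sum_distrib_left mult_ac)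
  also have "(\<Sum>i\<in>UNIV. \<Sum>j\<in>UNIV. mconst (y $ i * t $ j) * linear_form (?l i j))
      = linear_form (\<lambda>w. \<Sum>i\<in>UNIV. \<Sum>j\<in>UNIV. (y $ i * t $ j) * ?l i j w)"
    by (simp add: linear_form_sum linear_form_scale)
  also have "(\<lambda>w. \<Sum>i\<in>UNIV. \<Sum>j\<in>UNIV. (y $ i * t $ j) * ?l i j w) = (\<lambda>w. hessian y w t)"
    unfolding hessian_commute[of y _ t] by (simp add: hessian_def sum_distrib_left mult_ac)
  finally show ?thesis .
qed

lemma directional_deriv_eval:
  assumes "coefficient_hom \<iota>"
  shows "mpoly_eval \<iota> (\<lambda>j. \<Sum>l\<in>L. \<iota> (p l $ j) * z l) (directional_deriv y t)
    = \<iota> (slope y t) + (\<Sum>l\<in>L. \<iota> (hessian y (p l) t) * z l)"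
proof -
  interpret coefficient_hom \<iota> by fact
  show ?thesis
    by (simp add: directional_deriv_expand mpoly_eval_add mpoly_eval_linear_form[OF hessian_coordinates_left])
qed

lemma directional_deriv_eval_point:
  "mpoly_eval (\<lambda>c. c) (\<lambda>j. v $ j) (directional_deriv y t) = gradient v y t"
  using directional_deriv_eval[OF id_hom.coefficient_hom_axioms, of "\<lambda>_. v" "\<lambda>_. 1" "{()}"]
  by (simp add: gradient_def)

lemma directional_deriv_eval_line:
  "mpoly_eval (\<lambda>c. [:c:]) (\<lambda>j. [:v $ j, w $ j:]) (directional_deriv y t) = [:gradient v y t, hessian y w t:]"
  \<comment> \<open>The two summands of \<open>v + s w\<close> are indexed by booleans:
    \<open>True\<close> carries \<open>v\<close> with weight 1, \<open>False\<close> carries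
    \<open>w\<close> with weight s.\<close>
  using directional_deriv_eval[OF const_poly_hom.coefficient_hom_axioms,
      of "\<lambda>l. if l then v else w" "\<lambda>l. if l then 1 else [:0, 1:]" UNIV]
  by (simp add: gradient_def UNIV_bool add.commute)

text \<open>The Taylor expansion at \<open>v\<close> in the directions \<open>e1\<close>,
  \<open>e2\<close>, exact in degree two. The constant subtracted is the value of the combination at
  \<open>v\<close>.\<close>

lemma combination_eval:
  "mpoly_eval (\<lambda>c. [:c:]) (\<lambda>j. [:v $ j:] + [:e1 $ j:] * z1 + [:e2 $ j:] * z2)
      (combination y - mconst (constant_term y + slope y v + hessian y v v / 2))
    = [:gradient v y e1:] * z1 + [:gradient v y e2:] * z2 + [:hessian y e1 e1 / 2:] * z1\<^sup>2
      + [:hessian y e1 e2:] * (z1 * z2) + [:hessian y e2 e2 / 2:] * z2\<^sup>2"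
proof -
  define p where "p l = (if l = 0 then v else if l = 1 then e1 else e2)" for l :: nat
  define z where "z l = (if l = 0 then 1 else if l = 1 then z1 else z2)" for l :: nat
  let ?a = "\<lambda>j. \<Sum>l\<in>{0,1,2::nat}. [:p l $ j:] * z l"
  let ?E = "mpoly_eval (\<lambda>c. [:c:]) ?a"
  have a: "?a = (\<lambda>j. [:v $ j:] + [:e1 $ j:] * z1 + [:e2 $ j:] * z2)"
    by (simp add: p_def z_def add.assoc)
  have lin: "?E (linear_form (slope y)) = [:slope y v:] + [:slope y e1:] * z1 + [:slope y e2:] * z2"
    by (subst const_poly_hom.mpoly_eval_linear_form[OF slope_coordinates])
      (simp add: p_def z_def add.assoc)
  have "?E (bilinear_form (hessian y)) = [:hessian y v v:]
      + [:hessian y v e1 + hessian y e1 v:] * z1 + [:hessian y v e2 + hessian y e2 v:] * z2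
      + [:hessian y e1 e1:] * z1\<^sup>2 + [:hessian y e1 e2 + hessian y e2 e1:] * (z1 * z2)
      + [:hessian y e2 e2:] * z2\<^sup>2"
    by (subst const_poly_hom.mpoly_eval_bilinear_form[OF hessian_coordinates])
      (simp add: p_def z_def power2_eq_square smult_add_left algebra_simps)
  then have bil: "[:1/2:] * ?E (bilinear_form (hessian y)) = [:hessian y v v / 2:]
      + [:hessian y v e1:] * z1 + [:hessian y v e2:] * z2
      + [:hessian y e1 e1 / 2:] * z1\<^sup>2 + [:hessian y e1 e2:] * (z1 * z2)
      + [:hessian y e2 e2 / 2:] * z2\<^sup>2"
    using two by (simp add: hessian_commute[of y e1 v] hessian_commute[of y e2 v]
        hessian_commute[of y e2 e1] smult_add_right mult_2[symmetric])
  show ?thesis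
    unfolding a[symmetric] combination_expand
    by (simp only: const_poly_hom.mpoly_eval_add const_poly_hom.mpoly_eval_diff
        const_poly_hom.mpoly_eval_mult const_poly_hom.mpoly_eval_mconst lin bil)
      (simp add: gradient_def smult_add_left)
qed

end

section \<open>From the rank of the Jacobian to vanishing and nonvanishing minors\<close>

context quadratic_data
begin

definition jacobian_row :: "'k^'m \<Rightarrow> ('n, 'k) mratfun ^ 'n::{finite,linorder}"
  where "jacobian_row y = (\<Sum>i\<in>UNIV. ratconst (y $ i) *s jacobian_matrix H $ i)"

lemma jacobian_row_in_span: "jacobian_row y \<in> vec.span (rows (jacobian_matrix H))"
  unfolding jacobian_row_def
proof (intro vec.span_sum vec.span_scale vec.span_base)
  show "jacobian_matrix H $ i \<in> rows (jacobian_matrix H)" for i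
    by (auto simp: rows_def row_def vec_lambda_eta)
qed

lemma to_mratfun_directional_deriv:
  "to_mratfun (directional_deriv y t) = (\<Sum>j\<in>UNIV. ratconst (t $ j) * jacobian_row y $ j)"
proof -
  have "(\<Sum>j\<in>UNIV. ratconst (t $ j) * jacobian_row y $ j)
    = (\<Sum>j\<in>UNIV. \<Sum>i\<in>UNIV. ratconst (y $ i) * ratconst (t $ j) * jacobian_matrix H $ i $ j)"
    by (simp add: jacobian_row_def sum_distrib_left mult_ac)
  also have "\<dots> = (\<Sum>i\<in>UNIV. \<Sum>j\<in>UNIV. ratconst (y $ i) * ratconst (t $ j) * jacobian_matrix H $ i $ j)"
    by (rule sum.swap)
  finally show ?thesis
    by (simp add: directional_deriv_def jacobian_matrix_def to_mratfun_sum to_mratfun_mult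
        ratconst_hom.hom_mult mult.assoc ratconst_def mconst_mult)
qed

lemma det2_directional_deriv:
  assumes "rank (jacobian_matrix H) \<le> 1"
  shows "det2 (directional_deriv y1) (directional_deriv y2) t1 t2 = 0"
proof -
  define R where "R k = jacobian_row (if k then y1 else y2)" for k
  obtain d k where d: "d k \<noteq> 0" "(\<Sum>k\<in>UNIV. d k *s R k) = 0"
    by (rule rows_dependent[of UNIV "jacobian_matrix H" R])
      (use assms jacobian_row_in_span in \<open>auto simp: R_def card_UNIV_bool\<close>)
  have "d True * to_mratfun (directional_deriv y1 t) + d False * to_mratfun (directional_deriv y2 t) = 0" for t
  proof -
    have "d True * to_mratfun (directional_deriv y1 t) + d False * to_mratfun (directional_deriv y2 t)
        = (\<Sum>j\<in>UNIV. ratconst (t $ j) * (\<Sum>k\<in>UNIV. d k *s R k) $ j)"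
      by (simp add: to_mratfun_directional_deriv UNIV_bool R_def sum_distrib_left sum.distrib
          distrib_left mult_ac add.commute)
    then show ?thesis by (simp add: d(2))
  qed
  moreover have "d True \<noteq> 0 \<or> d False \<noteq> 0" using d(1) by (cases k) auto
  ultimately have "det2 (\<lambda>t. to_mratfun (directional_deriv y1 t))
      (\<lambda>t. to_mratfun (directional_deriv y2 t)) t1 t2 = 0"
    by (rule det2_eq_0_if_dependent)
  then have "to_mratfun (det2 (directional_deriv y1) (directional_deriv y2) t1 t2) = 0"
    by (simp add: det2_def to_mratfun_diff to_mratfun_mult)
  then show ?thesis by simp
qed

lemma det3_directional_deriv:
  assumes "rank (jacobian_matrix H) \<le> 2"
  shows "det3 (directional_deriv y1) (directional_deriv y2) (directional_deriv y3) t1 t2 t3 = 0"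
proof -
  define R where "R k = jacobian_row (if k = 0 then y1 else if k = 1 then y2 else y3)" for k :: nat
  obtain d k where d: "k \<in> {0,1,2::nat}" "d k \<noteq> 0" "(\<Sum>k\<in>{0,1,2}. d k *s R k) = 0"
    by (rule rows_dependent[of "{0,1,2}" "jacobian_matrix H" R])
      (use assms jacobian_row_in_span in \<open>auto simp: R_def\<close>)
  have "d 0 * to_mratfun (directional_deriv y1 t) + d 1 * to_mratfun (directional_deriv y2 t)
    + d 2 * to_mratfun (directional_deriv y3 t) = 0" for t
  proof -
    have "d 0 * to_mratfun (directional_deriv y1 t) + d 1 * to_mratfun (directional_deriv y2 t)
        + d 2 * to_mratfun (directional_deriv y3 t)
        = (\<Sum>j\<in>UNIV. ratconst (t $ j) * (\<Sum>k\<in>{0,1,2}. d k *s R k) $ j)"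
      by (simp add: to_mratfun_directional_deriv R_def sum_distrib_left sum.distrib
          distrib_left mult_ac add.assoc)
    then show ?thesis by (simp only: d(3)) simp
  qed
  moreover have "d 0 \<noteq> 0 \<or> d 1 \<noteq> 0 \<or> d 2 \<noteq> 0" using d(1,2) by auto
  ultimately have "det3 (\<lambda>t. to_mratfun (directional_deriv y1 t))
      (\<lambda>t. to_mratfun (directional_deriv y2 t)) (\<lambda>t. to_mratfun (directional_deriv y3 t)) t1 t2 t3 = 0"
    by (rule det3_eq_0_if_dependent)
  then have "to_mratfun (det3 (directional_deriv y1) (directional_deriv y2) (directional_deriv y3) t1 t2 t3) = 0"
    by (simp add: det3_def det2_def to_mratfun_diff to_mratfun_mult to_mratfun_add)
  then show ?thesis by simp
qed

lemma rank_one_family: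
  assumes "rank (jacobian_matrix H) \<le> 1"
  shows "rank_one_family (gradient v) hessian"
proof
  fix y1 y2 t1 t2 w
  show "det2 (\<lambda>t. [:gradient v y1 t, hessian y1 w t:]) (\<lambda>t. [:gradient v y2 t, hessian y2 w t:]) t1 t2 = 0"
    using arg_cong[OF det2_directional_deriv[OF assms, of y1 y2 t1 t2],
        of "mpoly_eval (\<lambda>c. [:c:]) (\<lambda>j. [:v $ j, w $ j:])"]
    by (simp only: det2_def const_poly_hom.mpoly_eval_diff const_poly_hom.mpoly_eval_mult
        directional_deriv_eval_line const_poly_hom.mpoly_eval_0)
qed

lemma rank_two_family:
  assumes "rank (jacobian_matrix H) \<le> 2"
  shows "rank_two_family (gradient v) hessian"
proof
  fix y1 y2 y3 t1 t2 t3 w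
  show "det3 (\<lambda>t. [:gradient v y1 t, hessian y1 w t:]) (\<lambda>t. [:gradient v y2 t, hessian y2 w t:])
      (\<lambda>t. [:gradient v y3 t, hessian y3 w t:]) t1 t2 t3 = 0"
    using arg_cong[OF det3_directional_deriv[OF assms, of y1 y2 y3 t1 t2 t3],
        of "mpoly_eval (\<lambda>c. [:c:]) (\<lambda>j. [:v $ j, w $ j:])"]
    by (simp only: det3_def det2_def const_poly_hom.mpoly_eval_diff const_poly_hom.mpoly_eval_add
        const_poly_hom.mpoly_eval_mult directional_deriv_eval_line const_poly_hom.mpoly_eval_0)
qed

lemma partial_deriv_affine:
  obtains d f where "partial_deriv j (H $ i) = affine_mpoly d f"
  by (rule that, subst H, rule partial_deriv_quadratic_mpoly)

lemma nonzero_gradient_exists: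
  assumes "rank (jacobian_matrix H) \<noteq> 0"
  obtains v y t where "gradient v y t \<noteq> 0"
proof -
  obtain i j where "jacobian_matrix H $ i $ j \<noteq> 0"
    using assms rank_eq_0_if_zero[of "jacobian_matrix H"] by auto
  then have nz: "partial_deriv j (H $ i) \<noteq> 0" by (simp add: jacobian_matrix_def)
  obtain d f where "partial_deriv j (H $ i) = affine_mpoly d f" by (rule partial_deriv_affine)
  then have q: "partial_deriv j (H $ i) = quadratic_mpoly d f (\<lambda>_ _. 0)"
    by (simp add: quadratic_mpoly_def)
  obtain v where "mpoly_eval (\<lambda>c. c) v (partial_deriv j (H $ i)) \<noteq> 0"
    using quadratic_mpoly_eq_0_if_vanishes[OF two, of d f "\<lambda>_ _. 0"] nz unfolding q by blast
  then have "gradient (vec_lambda v) (axis i 1) (axis j 1) \<noteq> 0"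
    using directional_deriv_eval_point[of "vec_lambda v" "axis i 1" "axis j 1"]
    by (simp add: directional_deriv_axis)
  then show ?thesis by (rule that)
qed

lemma nonzero_minor_exists:
  assumes "rank (jacobian_matrix H) \<ge> 2"
  obtains v y1 y2 t1 t2 where "det2 (gradient v y1) (gradient v y2) t1 t2 \<noteq> 0"
proof -
  have "\<not> (\<forall>i i' j j'. jacobian_matrix H $ i $ j * jacobian_matrix H $ i' $ j'
      = jacobian_matrix H $ i $ j' * jacobian_matrix H $ i' $ j)"
    using assms rank_le_1_if_minors_vanish[of "jacobian_matrix H"] by fastforce
  then obtain i i' j j' where nz: "partial_deriv j (H $ i) * partial_deriv j' (H $ i')
      - partial_deriv j' (H $ i) * partial_deriv j (H $ i') \<noteq> 0" (is "?m \<noteq> 0")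
    by (auto simp: jacobian_matrix_def simp flip: to_mratfun_mult)
  \<comment> \<open>Partial derivatives are affine, so the minor is quadratic again. Degree two is
    the limit for finding a point where it is nonzero: x^3 - x vanishes on the field of three
    elements.\<close>
  have "\<exists>d f F. ?m = quadratic_mpoly d f F"
    by (simp only: H partial_deriv_quadratic_mpoly affine_mpoly_mult quadratic_mpoly_diff) blast
  then obtain d f F where q: "?m = quadratic_mpoly d f F" by blast
  obtain v where v: "mpoly_eval (\<lambda>c. c) v ?m \<noteq> 0"
    using quadratic_mpoly_eq_0_if_vanishes[OF two, of d f F] nz unfolding q by blast
  have "mpoly_eval (\<lambda>c. c) v (partial_deriv j (H $ i)) = gradient (vec_lambda v) (axis i 1) (axis j 1)"
    for i j
    using directional_deriv_eval_point[of "vec_lambda v" "axis i 1" "axis j 1"]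
    by (simp add: directional_deriv_axis)
  then have "det2 (gradient (vec_lambda v) (axis i 1)) (gradient (vec_lambda v) (axis i' 1))
      (axis j 1) (axis j' 1) \<noteq> 0"
    using v by (simp add: det2_def id_hom.mpoly_eval_diff id_hom.mpoly_eval_mult)
  then show ?thesis by (rule that)
qed

text \<open>A nonconstant polynomial can have zero gradient in positive characteristic. For degree
  two this is ruled out by combining this lemma with \<open>combination_expand\<close>, where 1/2
  enters.\<close>

lemma rank_0_flat:
  assumes "rank (jacobian_matrix H) = 0"
  shows "slope y = (\<lambda>_. 0)" "hessian y = (\<lambda>_ _. 0)"
proof -
  have "partial_deriv j (H $ i) = 0" for i j
    using rank_0_imp_zero[OF assms, of i j] by (simp add: jacobian_matrix_def)
  then have "directional_deriv y t = 0" for t by (simp add: directional_deriv_def)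
  then have z: "gradient v y t = 0 \<and> hessian y w t = 0" for v w t
    using directional_deriv_eval_line[of v w y t] by simp
  then show "hessian y = (\<lambda>_ _. 0)" by (intro ext) blast
  with z show "slope y = (\<lambda>_. 0)" by (simp add: gradient_def fun_eq_iff)
qed

section \<open>Generators of an algebra containing all components\<close>

definition nonconstant_part :: "'k^'m \<Rightarrow> ('n, 'k) mpoly"
  where "nonconstant_part y = linear_form (slope y) + mconst (1/2) * bilinear_form (hessian y)"

lemma combination_eq: "combination y = mconst (constant_term y) + nonconstant_part y"
  by (simp add: combination_expand nonconstant_part_def add.assoc)

lemma combination_in_subalgebra:
  assumes "mpoly_subalgebra S" "nonconstant_part y \<in> S"
  shows "combination y \<in> S"
  unfolding combination_eq using assms by (intro subalgebra_intros)

lemma nonconstant_part_in_subalgebra: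
  assumes "mpoly_subalgebra S" "combination h \<in> S"
  shows "nonconstant_part h \<in> S"
proof -
  have "combination h - mconst (constant_term h) \<in> S" using assms by (intro subalgebra_intros)
  then show ?thesis by (simp add: combination_eq)
qed

lemma generators_rank_1:
  assumes "rank (jacobian_matrix H) = 1"
  obtains f where "\<And>y. combination y \<in> generated_subalgebra {f}"
proof -
  obtain v y t where nz: "gradient v y t \<noteq> 0"
    by (rule nonzero_gradient_exists) (use assms in simp)
  interpret rank_one_family "gradient v" hessian
    by (rule rank_one_family) (simp add: assms)
  from nz show ?thesis
  proof (cases rule: classification)
    case (span h)
    let ?S = "generated_subalgebra {combination h}"
    have S: "mpoly_subalgebra ?S" by (rule mpoly_subalgebra_generated)
    have "combination h \<in> ?S" unfolding generated_subalgebra_def by (rule hull_inc) simp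
    note h = nonconstant_part_in_subalgebra[OF S this]
    show ?thesis
    proof (rule that)
      fix y
      obtain p where p: "\<And>t. gradient v y t = p * gradient v h t" "\<And>w t. hessian y w t = p * hessian h w t"
        using span by blast
      have hes: "hessian y = (\<lambda>w t. p * hessian h w t)" using p(2) by (intro ext)
      have slo: "slope y = (\<lambda>t. p * slope h t)"
      proof
        show "slope y t = p * slope h t" for t
          using p(1)[of t] p(2)[of v t] by (simp add: gradient_def distrib_left)
      qed
      have "nonconstant_part y = mconst p * nonconstant_part h"
        by (simp add: nonconstant_part_def hes slo form_simps algebra_simps)
      also have "\<dots> \<in> ?S" using S h by (intro subalgebra_intros)
      finally show "combination y \<in> ?S" by (rule combination_in_subalgebra[OF S])
    qed
  next
    case (line h)
    let ?f = "linear_form (gradient v h)"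
    let ?S = "generated_subalgebra {?f}"
    have S: "mpoly_subalgebra ?S" by (rule mpoly_subalgebra_generated)
    have f: "?f \<in> ?S" unfolding generated_subalgebra_def by (rule hull_inc) simp
    show ?thesis
    proof (rule that)
      fix y
      obtain p where p: "\<And>t. gradient v y t = p * gradient v h t" using line(1) by blast
      obtain q where q: "\<And>w t. hessian y w t = q * (gradient v h w * gradient v h t)"
        using line(2) by blast
      have hes: "hessian y = (\<lambda>w t. q * (gradient v h w * gradient v h t))" using q by (intro ext)
      \<comment> \<open>Moving the base point from \<open>v\<close> to the origin subtracts
        \<open>hessian y v\<close> from the differential, hence the correction by
        \<open>q * gradient v h v\<close>.\<close>
      have slo: "slope y = (\<lambda>t. (p - q * gradient v h v) * gradient v h t)"
      proof
        show "slope y t = (p - q * gradient v h v) * gradient v h t" for t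
          using p[of t] unfolding gradient_def[of v y t] q[of v t] by (simp add: algebra_simps)
      qed
      show "combination y \<in> ?S"
        by (rule combination_in_subalgebra[OF S])
          (simp only: nonconstant_part_def hes slo form_simps, intro subalgebra_intros S f)
    qed
  qed
qed

lemma generators_rank_2:
  assumes "rank (jacobian_matrix H) = 2"
  obtains f1 f2 where "\<And>y. combination y \<in> generated_subalgebra {f1, f2}"
proof -
  obtain v y1 y2 t1 t2 where nz: "det2 (gradient v y1) (gradient v y2) t1 t2 \<noteq> 0"
    by (rule nonzero_minor_exists) (use assms in simp)
  interpret rank_two_family "gradient v" hessian
    by (rule rank_two_family) (simp add: assms)
  have gen: "mpoly_subalgebra (generated_subalgebra {f, g})"
    "f \<in> generated_subalgebra {f, g}" "g \<in> generated_subalgebra {f, g}"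
    for f g :: "('n, 'k) mpoly"
    by (simp_all add: mpoly_subalgebra_generated) (simp_all add: generated_subalgebra_def hull_inc)
  from nz show ?thesis
  proof (cases rule: classification)
    case (span h1 h2)
    let ?S = "generated_subalgebra {combination h1, combination h2}"
    note S = gen(1)[of "combination h1" "combination h2"]
    note h1 = nonconstant_part_in_subalgebra[OF S gen(2)]
    note h2 = nonconstant_part_in_subalgebra[OF S gen(3)]
    show ?thesis
    proof (rule that)
      fix y
      obtain p q where p: "\<And>t. gradient v y t = p * gradient v h1 t + q * gradient v h2 t"
        "\<And>w t. hessian y w t = p * hessian h1 w t + q * hessian h2 w t"
        using span by blast
      have hes: "hessian y = (\<lambda>w t. p * hessian h1 w t + q * hessian h2 w t)" using p(2) by (intro ext)
      have slo: "slope y = (\<lambda>t. p * slope h1 t + q * slope h2 t)"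
      proof
        show "slope y t = p * slope h1 t + q * slope h2 t" for t
          using p(1)[of t] p(2)[of v t] by (simp add: gradient_def algebra_simps)
      qed
      have "nonconstant_part y = mconst p * nonconstant_part h1 + mconst q * nonconstant_part h2"
        by (simp add: nonconstant_part_def hes slo form_simps algebra_simps)
      also have "\<dots> \<in> ?S" using S h1 h2 by (intro subalgebra_intros)
      finally show "combination y \<in> ?S" by (rule combination_in_subalgebra[OF S])
    qed
  next
    case (plane h1 h2)
    define \<alpha> \<beta> where "\<alpha> = gradient v h1" and "\<beta> = gradient v h2"
    let ?S = "generated_subalgebra {linear_form \<alpha>, linear_form \<beta>}"
    note S = gen[where f = "linear_form \<alpha>" and g = "linear_form \<beta>"]
    show ?thesis
    proof (rule that)
      fix y
      obtain p q where p: "\<And>t. gradient v y t = p * \<alpha> t + q * \<beta> t"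
        using plane(1) unfolding \<alpha>_def \<beta>_def by blast
      obtain p' q' r' where q: "\<And>w t. hessian y w t = p' * (\<alpha> w * \<alpha> t)
          + q' * (\<alpha> w * \<beta> t + \<beta> w * \<alpha> t) + r' * (\<beta> w * \<beta> t)"
        using plane(2) unfolding \<alpha>_def \<beta>_def by blast
      have hes: "hessian y = (\<lambda>w t. p' * (\<alpha> w * \<alpha> t)
          + q' * (\<alpha> w * \<beta> t + \<beta> w * \<alpha> t) + r' * (\<beta> w * \<beta> t))"
        using q by (intro ext)
      have slo: "slope y = (\<lambda>t. (p - p' * \<alpha> v - q' * \<beta> v) * \<alpha> t + (q - q' * \<alpha> v - r' * \<beta> v) * \<beta> t)"
      proof
        show "slope y t = (p - p' * \<alpha> v - q' * \<beta> v) * \<alpha> t + (q - q' * \<alpha> v - r' * \<beta> v) * \<beta> t" for t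
          using p[of t] unfolding gradient_def[of v y t] q[of v t] by (simp add: algebra_simps)
      qed
      show "combination y \<in> ?S"
        by (rule combination_in_subalgebra[OF S(1)])
          (simp only: nonconstant_part_def hes slo form_simps, intro subalgebra_intros S)
    qed
  next
    case (mixed h1 h2)
    define \<alpha> where "\<alpha> = gradient v h1"
    let ?S = "generated_subalgebra {linear_form \<alpha>, combination h2}"
    note S = gen[where f = "linear_form \<alpha>" and g = "combination h2"]
    note h2 = nonconstant_part_in_subalgebra[OF S(1,3)]
    show ?thesis
    proof (rule that)
      fix y
      obtain p q r where p: "\<And>t. gradient v y t = p * \<alpha> t + q * gradient v h2 t"
        "\<And>w t. hessian y w t = q * hessian h2 w t + r * (\<alpha> w * \<alpha> t)"
        using mixed unfolding \<alpha>_def by blast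
      have hes: "hessian y = (\<lambda>w t. q * hessian h2 w t + r * (\<alpha> w * \<alpha> t))" using p(2) by (intro ext)
      have slo: "slope y = (\<lambda>t. (p - r * \<alpha> v) * \<alpha> t + q * slope h2 t)"
      proof
        show "slope y t = (p - r * \<alpha> v) * \<alpha> t + q * slope h2 t" for t
          using p(1)[of t] unfolding gradient_def[of v y t] gradient_def[of v h2 t] p(2)[of v t]
          by (simp add: algebra_simps)
      qed
      \<comment> \<open>The same \<open>q\<close> multiplies slope and Hessian of \<open>h2\<close>,
        so these reassemble to the nonconstant part of \<open>h2\<close>.\<close>
      have "nonconstant_part y = mconst (p - r * \<alpha> v) * linear_form \<alpha>
          + mconst (1/2) * (mconst r * (linear_form \<alpha> * linear_form \<alpha>)) + mconst q * nonconstant_part h2"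
        by (simp only: nonconstant_part_def hes slo form_simps) (simp only: algebra_simps)
      also have "\<dots> \<in> ?S" using S h2 by (intro subalgebra_intros)
      finally show "combination y \<in> ?S" by (rule combination_in_subalgebra[OF S(1)])
    qed
  qed
qed

lemma generators_exist:
  assumes "rank (jacobian_matrix H) \<le> 2"
  shows "\<exists>f :: nat \<Rightarrow> ('n, 'k) mpoly. range (\<lambda>i. H $ i)
    \<subseteq> generated_subalgebra (f ` {1..rank (jacobian_matrix H)})"
proof -
  consider "rank (jacobian_matrix H) = 0" | "rank (jacobian_matrix H) = 1"
    | "rank (jacobian_matrix H) = 2"
    using assms by linarith
  then show ?thesis
  proof cases
    case 1
    have "linear_form (\<lambda>_. 0) = (0 :: ('n, 'k) mpoly)" "bilinear_form (\<lambda>_ _. 0) = (0 :: ('n, 'k) mpoly)"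
      by (simp_all add: linear_form_def bilinear_form_def)
    then have "H $ i = mconst (constant_term (axis i 1))" for i
      by (simp add: combination_expand rank_0_flat[OF 1] flip: combination_axis)
    then show ?thesis
      using constants_in_subalgebra[OF mpoly_subalgebra_generated] by (metis image_subsetI)
  next
    case 2
    obtain f where f: "\<And>y. combination y \<in> generated_subalgebra {f}"
      by (rule generators_rank_1[OF 2]) blast
    have "H $ i \<in> generated_subalgebra {f}" for i using f[of "axis i 1"] by (simp add: combination_axis)
    then show ?thesis unfolding 2 by (intro exI[of _ "\<lambda>_. f"]) auto
  next
    case 3
    obtain f1 f2 where f: "\<And>y. combination y \<in> generated_subalgebra {f1, f2}"
      by (rule generators_rank_2[OF 3]) blast
    have "H $ i \<in> generated_subalgebra {f1, f2}" for i
      using f[of "axis i 1"] by (simp add: combination_axis)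
    moreover have "(\<lambda>k. if k = 1 then f1 else f2) ` {1..2::nat} = {f1, f2}"
    proof -
      have "{1..2::nat} = {1, 2}" by auto
      then show ?thesis by auto
    qed
    ultimately show ?thesis
      unfolding 3 by (intro exI[of _ "\<lambda>k. if k = 1 then f1 else f2"]) auto
  qed
qed

section \<open>Lower bound for the transcendence degree\<close>

lemma translate_in_generated_field:
  "to_mratfun (combination y - mconst d)
    \<in> generated_field ratconst (range (\<lambda>i. to_mratfun (H $ i)))" (is "_ \<in> ?F")
proof -
  have F: "intermediate_field ratconst ?F" by (rule intermediate_field_generated)
  have const: "ratconst d \<in> ?F" for d
    using F by (auto simp: intermediate_field_def)
  have add: "p + q \<in> ?F" "p * q \<in> ?F" "- p \<in> ?F" if "p \<in> ?F" "q \<in> ?F" for p q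
    using F that unfolding intermediate_field_def by blast+
  have H: "to_mratfun (H $ i) \<in> ?F" for i
    unfolding generated_field_def by (rule hull_inc) simp
  have "(\<Sum>i\<in>I. ratconst (y $ i) * to_mratfun (H $ i)) \<in> ?F" for I
  proof (induction I rule: infinite_finite_induct)
    case empty
    show ?case using const[of 0] by (simp add: ratconst_hom.hom_0)
  next
    case infinite
    then show ?case using const[of 0] by (simp add: ratconst_hom.hom_0)
  next
    case (insert i I)
    then show ?case using add const H by simp
  qed
  then have "(\<Sum>i\<in>UNIV. ratconst (y $ i) * to_mratfun (H $ i)) + - ratconst d \<in> ?F"
    using add const by blast
  then show ?thesis
    by (simp add: combination_def to_mratfun_diff to_mratfun_sum to_mratfun_mult ratconst_def)
qed

lemma trdeg_ge_rank:
  assumes "rank (jacobian_matrix H) \<le> 2"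
  shows "enat (rank (jacobian_matrix H)) \<le> trdeg (ratconst :: 'k \<Rightarrow> ('n, 'k) mratfun)
    (generated_field ratconst (range (\<lambda>i. to_mratfun (H $ i))))" (is "_ \<le> trdeg _ ?F")
proof -
  have inj: "card (to_mratfun ` Q) = card Q" for Q :: "('n, 'k) mpoly set"
    by (rule card_image) (auto simp: inj_on_def)
  consider "rank (jacobian_matrix H) = 0" | "rank (jacobian_matrix H) = 1"
    | "rank (jacobian_matrix H) = 2"
    using assms by linarith
  then show ?thesis
  proof cases
    case 1
    then show ?thesis by (simp flip: zero_enat_def)
  next
    case 2
    obtain v y e where nz: "gradient v y e \<noteq> 0"
      by (rule nonzero_gradient_exists) (use 2 in simp)
    define h where "h = (1 / gradient v y e) *s y"
    have h: "gradient v h e = 1" using nz by (simp add: h_def family.g_scale_left)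
    define q where "q = combination h - mconst (constant_term h + slope h v + hessian h v v / 2)"
    \<comment> \<open>The line \<open>v + s e\<close>; the second direction is a zero dummy, so that
      \<open>combination_eval\<close> applies.\<close>
    define a where "a j = [:v $ j:] + [:e $ j:] * monom 1 1 + [:0 $ j:] * 0" for j
    define u where "u = 1 + [:hessian h e e / 2:] * monom 1 1"
    have "mpoly_eval (\<lambda>c. [:c:]) a q = monom 1 1 * u" "coeff u 0 = 1"
      unfolding q_def a_def
      by (subst combination_eval) (simp_all add: u_def h power2_eq_square algebra_simps)
    then have "algebraically_independent (ratconst :: 'k \<Rightarrow> ('n, 'k) mratfun) (to_mratfun ` {q})"
      by (intro algebraically_independent_by_order exI[of _ a] exI[of _ "\<lambda>_. 1"]) auto
    then have "enat (card (to_mratfun ` {q})) \<le> trdeg (ratconst :: 'k \<Rightarrow> ('n, 'k) mratfun) ?F"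
      using translate_in_generated_field by (intro card_le_trdeg) (auto simp: q_def)
    then show ?thesis by (simp add: 2)
  next
    case 3
    obtain v y1 y2 e1 e2 where "det2 (gradient v y1) (gradient v y2) e1 e2 \<noteq> 0"
      by (rule nonzero_minor_exists) (use 3 in simp)
    then obtain h1 h2 where "family.dual_pair v h1 h2 e1 e2"
      by (rule family.dual_pair_exists)
    then have h: "gradient v h1 e1 = 1" "gradient v h1 e2 = 0" "gradient v h2 e1 = 0" "gradient v h2 e2 = 1"
      by (auto simp: family.dual_pair_def)
    define q where "q h = combination h - mconst (constant_term h + slope h v + hessian h v v / 2)" for h
    define a where "a N = (\<lambda>j. [:v $ j:] + [:e1 $ j:] * monom 1 N + [:e2 $ j:] * monom 1 (Suc N))" for N :: nat
    let ?E = "\<lambda>N. mpoly_eval (\<lambda>c. [:c:]) (a N)"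
    have eval: "?E N (q h) = [:gradient v h e1:] * monom 1 N + [:gradient v h e2:] * monom 1 (Suc N)
      + [:hessian h e1 e1 / 2:] * (monom 1 N)\<^sup>2 + [:hessian h e1 e2:] * (monom 1 N * monom 1 (Suc N))
      + [:hessian h e2 e2 / 2:] * (monom 1 (Suc N))\<^sup>2" for N h
      unfolding q_def a_def by (rule combination_eval)
    have E1: "\<exists>u. ?E (N + 2) (q h1) = monom 1 (N + 2) * u \<and> coeff u 0 = 1" for N
      by (rule exI[of _ "1 + [:hessian h1 e1 e1 / 2:] * monom 1 (N + 2)
          + [:hessian h1 e1 e2:] * monom 1 (N + 3) + [:hessian h1 e2 e2 / 2:] * monom 1 (N + 4)"])
        (simp add: eval h power2_eq_square mult_monom smult_monom distrib_left eval_nat_numeral)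
    \<comment> \<open>The quadratic terms have order at least 2(N + 2), which exceeds N + 3 for
      every N. This is why the exponent is shifted by 2: with exponents 1 and 2 the square of the
      first would interfere.\<close>
    have E2: "\<exists>u. ?E (N + 2) (q h2) = monom 1 (N + 3) * u \<and> coeff u 0 = 1" for N
      by (rule exI[of _ "1 + [:hessian h2 e1 e1 / 2:] * monom 1 (N + 1)
          + [:hessian h2 e1 e2:] * monom 1 (N + 2) + [:hessian h2 e2 e2 / 2:] * monom 1 (N + 3)"])
        (simp add: eval h power2_eq_square mult_monom smult_monom distrib_left eval_nat_numeral)
    have neq: "q h1 \<noteq> q h2"
    proof
      assume "q h1 = q h2"
      moreover from E1[of 0] obtain u where u: "?E (0 + 2) (q h1) = monom 1 (0 + 2) * u" "coeff u 0 = 1"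
        by blast
      moreover from E2[of 0] obtain u' where "?E (0 + 2) (q h2) = monom 1 (0 + 3) * u'" by blast
      ultimately have "monom 1 (0 + 2) * u = monom 1 (0 + 3) * u'" by (simp only:)
      from arg_cong[OF this, of "\<lambda>p. coeff p 2"] u(2) show False by (simp add: coeff_monom_mult)
    qed
    have "algebraically_independent (ratconst :: 'k \<Rightarrow> ('n, 'k) mratfun) (to_mratfun ` {q h1, q h2})"
    proof (rule algebraically_independent_by_order)
      fix N :: nat
      define w where "w p = (if p = q h1 then N + 2 else N + 3)" for p
      \<comment> \<open>Since \<open>f (q h2) < N\<close>, this is a division with remainder by N +
        2: the remainder determines the exponent of \<open>q h2\<close>, and the quotient then that
        of \<open>q h1\<close>.\<close>
      have w: "(\<Sum>p\<in>{q h1, q h2}. f p * w p) = (f (q h1) + f (q h2)) * (N + 2) + f (q h2)" for f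
        using neq by (simp add: w_def algebra_simps)
      have "\<forall>p\<in>{q h1, q h2}. f p = f' p"
        if less: "\<forall>p\<in>{q h1, q h2}. f p < N \<and> f' p < N"
          and eq: "(\<Sum>p\<in>{q h1, q h2}. f p * w p) = (\<Sum>p\<in>{q h1, q h2}. f' p * w p)" for f f'
      proof -
        have *: "(f (q h1) + f (q h2)) * (N + 2) + f (q h2)
            = (f' (q h1) + f' (q h2)) * (N + 2) + f' (q h2)"
          using eq by (simp only: w)
        have "(x * (N + 2) + y) mod (N + 2) = y" if "y < N" for x y
          using that by (simp only: mod_mult_self3) simp
        with arg_cong[OF *, of "\<lambda>x. x mod (N + 2)"] less have 2: "f (q h2) = f' (q h2)"
          by (metis insertCI)
        from * have "f (q h1) = f' (q h1)"
          unfolding 2 by (simp only: add_right_cancel mult_cancel2) simp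
        with 2 show ?thesis by simp
      qed
      moreover have "\<forall>p\<in>{q h1, q h2}. \<exists>u. ?E (N + 2) p = monom 1 (w p) * u \<and> coeff u 0 = 1"
        using E1[of N] E2[of N] neq by (auto simp: w_def)
      ultimately show "\<exists>a w. (\<forall>p\<in>{q h1, q h2}. \<exists>u. mpoly_eval (\<lambda>c. [:c:]) a p = monom 1 (w p) * u \<and> coeff u 0 = 1)
        \<and> (\<forall>f f'. (\<forall>p\<in>{q h1, q h2}. f p < N \<and> f' p < N)
          \<longrightarrow> (\<Sum>p\<in>{q h1, q h2}. f p * w p) = (\<Sum>p\<in>{q h1, q h2}. f' p * w p)
          \<longrightarrow> (\<forall>p\<in>{q h1, q h2}. f p = f' p))"
        by (intro exI[of _ "a (N + 2)"] exI[of _ w]) blast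
    qed simp
    then have "enat (card (to_mratfun ` {q h1, q h2})) \<le> trdeg (ratconst :: 'k \<Rightarrow> ('n, 'k) mratfun) ?F"
      using translate_in_generated_field by (intro card_le_trdeg) (auto simp: q_def)
    moreover have "card {q h1, q h2} = 2" using neq by simp
    ultimately show ?thesis by (simp only: inj 3)
  qed
qed

end

text \<open>The polynomials whose image lies in \<open>F\<close> form a subalgebra, so minimality of
  the generated one applies.\<close>

lemma to_mratfun_in_intermediate_field:
  assumes F: "intermediate_field ratconst F" and S: "to_mratfun ` S \<subseteq> F"
    and p: "p \<in> generated_subalgebra S"
  shows "to_mratfun p \<in> F"
proof -
  have "generated_subalgebra S \<subseteq> {p. to_mratfun p \<in> F}"
    unfolding generated_subalgebra_def
  proof (rule hull_minimal)
    show "S \<subseteq> {p. to_mratfun p \<in> F}" using S by blast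
    show "mpoly_subalgebra {p. to_mratfun p \<in> F}"
      using F by (auto simp: mpoly_subalgebra_def intermediate_field_def to_mratfun_add
          to_mratfun_mult image_subset_iff ratconst_def)
  qed
  with p show ?thesis by blast
qed

theorem corollary2p4:
  fixes H :: "('n::{finite,linorder}, 'k::field) mpoly ^ 'm::finite"
    and r :: nat
  assumes "(2::'k) \<noteq> 0"
    and "quadratic_map H"
    and "r = rank (jacobian_matrix H)"
    and "r \<le> 2"
  shows "(\<exists>f :: nat \<Rightarrow> ('n, 'k) mpoly.
            generated_subalgebra (range (\<lambda>i. H $ i)) \<subseteq> generated_subalgebra (f ` {1..r}))
       \<and> enat (rank (jacobian_matrix H)) =
           trdeg (ratconst :: 'k \<Rightarrow> ('n, 'k) mratfun)
             (generated_field ratconst (range (\<lambda>i. to_mratfun (H $ i))))"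
proof -
  have "total_degree (H $ i) \<le> 2" for i
  proof -
    have "total_degree (H $ i) \<le> map_degree H" unfolding map_degree_def by (rule Max_ge) auto
    then show ?thesis using assms(2) by (simp add: quadratic_map_def)
  qed
  then have "\<forall>i. \<exists>c b A. H $ i = quadratic_mpoly c b A"
    using total_degree_le_2_quadratic_mpoly by blast
  then obtain c b A where "\<And>i. H $ i = quadratic_mpoly (c i) (b i) (A i)"
    by metis
  then interpret quadratic_data c b A H
    using assms(1) by unfold_locales
  let ?F = "generated_field (ratconst :: 'k \<Rightarrow> ('n, 'k) mratfun)"
  obtain f :: "nat \<Rightarrow> ('n, 'k) mpoly" where f: "range (\<lambda>i. H $ i) \<subseteq> generated_subalgebra (f ` {1..r})"
    using generators_exist assms(3,4) by blast
  have "generated_subalgebra (range (\<lambda>i. H $ i)) \<subseteq> generated_subalgebra (f ` {1..r})"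
    unfolding generated_subalgebra_def[of "range _"]
    by (rule hull_minimal[of _ _ mpoly_subalgebra, OF f mpoly_subalgebra_generated])
  \<comment> \<open>All components lie in the algebra, hence in the field, generated by
    \<open>f\<close> on \<open>{1..r}\<close>. Indexing the generators keeps the bound
    \<open>r\<close> even if some of them coincide.\<close>
  moreover have "trdeg ratconst (?F (range (\<lambda>i. to_mratfun (H $ i)))) \<le> enat r"
  proof -
    let ?L = "?F ((\<lambda>k. to_mratfun (f k)) ` {1..r})"
    have L: "intermediate_field ratconst ?L" by (rule intermediate_field_generated)
    have "to_mratfun ` f ` {1..r} \<subseteq> ?L"
      unfolding generated_field_def image_image by (rule hull_subset)
    then have "range (\<lambda>i. to_mratfun (H $ i)) \<subseteq> ?L"
      using f to_mratfun_in_intermediate_field[OF L] by blast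
    then have "?F (range (\<lambda>i. to_mratfun (H $ i))) \<subseteq> ?L"
      unfolding generated_field_def[of _ "range _"]
      by (rule hull_minimal[of _ _ "intermediate_field ratconst", OF _ L])
    then have "trdeg ratconst (?F (range (\<lambda>i. to_mratfun (H $ i)))) \<le> trdeg ratconst ?L"
      by (rule trdeg_mono)
    also have "\<dots> \<le> enat (card {1..r})"
      by (rule ratconst_hom.trdeg_generated_field_le) simp
    finally show ?thesis by simp
  qed
  ultimately show ?thesis
    using f trdeg_ge_rank assms(3,4) by (metis antisym)
qed

end
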